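(* The possible values of $|A^*|$, when $A$ ranges over the rings with $1$ of finite (i.e. positive) characteristic with finite abelian group of units, are all the products of numbers of type $(p^\lambda-1)p^{\lambda k}$ where $p\mid \mathrm{char}(A)$ is prime, $\lambda\ge 1$ and $k\ge 0$, with at least one factor of this type for each prime divisor $p$ of $\mathrm{char}(A)$. Precisely: let $S$ be a finite non-empty set of primes and $n$ a positive integer. Then there exists a ring $A$ with $1$ of finite characteristic, with $A^*$ finite abelian, such that the set of prime divisors of $\mathrm{char}(A)$ is $S$ and $|A^*|=n$, if and only if $n$ can be written as a finite product $$n=\prod_{j=1}^{s}(p_j^{\lambda_j}-1)\,p_j^{\lambda_jk_j},\qquad p_j\in S,\ \lambda_j\ge 1,\ k_j\ge 0 \text{ integers},$$ in which each $p\in S$ equals $p_j$ for at least one index $j$.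
   Context: $A^*$ denotes the group of units of a ring $A$, and $\mathrm{char}(A)$ its characteristic. *)

theory Defs
  imports "HOL-Algebra.Algebra" "HOL-Computational_Algebra.Primes"
begin

text \<open>The value 0 encodes characteristic zero, so a ring has finite (positive) characteristic
  iff \<open>ring_char A > 0\<close>. The zero ring has characteristic 1.\<close>

definition ring_char :: "('a, 'b) ring_scheme \<Rightarrow> nat"
  where "ring_char A =
    (if \<exists>m::nat. m > 0 \<and> [m] \<cdot>\<^bsub>A\<^esub> \<one>\<^bsub>A\<^esub> = \<zero>\<^bsub>A\<^esub>
     then LEAST m::nat. m > 0 \<and> [m] \<cdot>\<^bsub>A\<^esub> \<one>\<^bsub>A\<^esub> = \<zero>\<^bsub>A\<^esub>
     else 0)"

end

theory Submission
  imports Defs "HOL-Number_Theory.Residues"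
begin

text \<open>
  Necessity. Let \<open>A\<close> be a ring of positive characteristic whose group of units is finite and abelian.
  The finite sums of units form a subring of \<open>A\<close> (\<open>unit_span\<close>) that is commutative, has the same
  characteristic and the same units, and is finite because it is additively generated by finitely
  many elements of finite order. So \<open>A\<close> may be replaced by a finite commutative ring \<open>R\<close>. For such a
  ring the primes dividing the characteristic are those dividing the cardinality
  (\<open>prime_dvd_ring_char_iff\<close>). A nontrivial idempotent splits \<open>R\<close> as a product of two smaller rings,
  and both the number of units and the cardinality are multiplicative. If there is no nontrivial
  idempotent, the nonunits are nilpotent and form an ideal \<open>M\<close>, the residue field has a prime power
  order \<open>q = p ^ l\<close>, and every ideal has \<open>q\<close>-power order (\<open>local_ring_ideal_card\<close>). With \<open>card M = q ^ k\<close>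
  the ring has \<open>q ^ (k + 1)\<close> elements and \<open>q ^ (k + 1) - q ^ k = (q - 1) * q ^ k\<close> units.

  Sufficiency. Over the field \<open>F\<close> of order \<open>q = p ^ l\<close>, found among the fixed points of a power of the
  Frobenius map in an algebraic closure of the prime field (\<open>exists_finite_field\<close>), the trivial
  extension \<open>F \<ltimes> F ^ k\<close> has \<open>(q - 1) * q ^ k\<close> units and order \<open>q ^ (k + 1)\<close>. A direct product of such
  rings realises any given product; being finite, it has a copy on any infinite type.
\<close>

section \<open>Characteristic and order of a finite ring\<close>

text \<open>Products of ideals share their infix symbol with the integer multiples \<open>[n] \<cdot> x\<close>;
  only the latter are used below.\<close>

no_notation ideal_prod (infixl "\<cdot>\<index>" 80)

lemma (in ring) ring_char_annihilates:
  assumes "ring_char R > 0"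
  shows "[ring_char R] \<cdot> \<one> = \<zero>"
proof -
  have "\<exists>m::nat. m > 0 \<and> [m] \<cdot> \<one> = \<zero>"
    using assms by (auto simp: ring_char_def split: if_splits)
  from LeastI_ex[OF this] show ?thesis
    using assms by (auto simp: ring_char_def split: if_splits)
qed

lemma (in ring) ring_char_le:
  assumes "[m] \<cdot> \<one> = \<zero>" "m > (0::nat)"
  shows "ring_char R > 0" "ring_char R \<le> m"
proof -
  have ex: "\<exists>m::nat. m > 0 \<and> [m] \<cdot> \<one> = \<zero>" using assms by auto
  have "ring_char R = (LEAST m::nat. m > 0 \<and> [m] \<cdot> \<one> = \<zero>)"
    using ex by (simp add: ring_char_def)
  then show "ring_char R > 0" "ring_char R \<le> m"
    using LeastI_ex[OF ex] Least_le[of "\<lambda>m::nat. m > 0 \<and> [m] \<cdot> \<one> = \<zero>" m] assms by auto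
qed

lemma (in ring) add_pow_one_mult:
  assumes "x \<in> carrier R"
  shows "([(m::nat)] \<cdot> \<one>) \<otimes> x = [m] \<cdot> x"
  using add_pow_ldistr[of \<one> x m] assms by simp

lemma (in ring) add_pow_coprime_zero:
  assumes "x \<in> carrier R" "[(a::nat)] \<cdot> x = \<zero>" "[(b::nat)] \<cdot> x = \<zero>" "coprime a b"
  shows "x = \<zero>"
proof (cases "a = 0 \<or> b = 0")
  case True
  then show ?thesis using assms by (auto simp: add.nat_pow_eone)
next
  case False
  then obtain u v where uv: "u * a = v * b + 1"
    using bezout_nat[of a b] assms(4) by (auto simp: coprime_iff_gcd_eq_1 mult.commute)
  have mult0: "[(u * c)] \<cdot> x = \<zero>" if "[c] \<cdot> x = \<zero>" for u c :: nat
    using add.nat_pow_pow[OF assms(1), of u c] add.nat_pow_pow[OF assms(1), of c u] that by (simp add: mult.commute)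
  have "\<zero> = [(u * a)] \<cdot> x" using mult0 assms(2) by simp
  also have "\<dots> = [(v * b)] \<cdot> x \<oplus> [(1::nat)] \<cdot> x"
    using assms(1) uv by (simp add: add.nat_pow_mult)
  also have "\<dots> = x" using mult0[OF assms(3)] assms(1) by simp
  finally show ?thesis by simp
qed

text \<open>A weak additive form of Cauchy's theorem, with a prime power in place of the prime.\<close>

lemma (in ring) exists_prime_torsion:
  assumes fin: "finite (carrier R)" and p: "Factorial_Ring.prime (p::nat)" and dvd: "p dvd card (carrier R)"
  shows "\<exists>x\<in>carrier R. \<exists>a. x \<noteq> \<zero> \<and> [(p ^ a)] \<cdot> x = \<zero>"
proof -
  obtain m where m: "order (add_monoid R) = p ^ 1 * m"
    using dvd by (auto simp: order_def dvd_def)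
  obtain H where H: "subgroup H (add_monoid R)" "card H = p ^ 1"
    using sylow_thm[OF p a_group m] fin by auto
  have "finite H" using H fin subgroup.subset finite_subset by fastforce
  have "\<zero> \<in> H" using subgroup.one_closed[OF H(1)] by simp
  have "card H > 1" using H(2) prime_gt_1_nat[OF p] by simp
  then have "\<exists>x\<in>H. x \<noteq> \<zero>"
    by (metis \<open>\<zero> \<in> H\<close> \<open>finite H\<close> card_le_Suc0_iff_eq leD One_nat_def)
  then obtain x where x: "x \<in> H" "x \<noteq> \<zero>" by blast
  have xc: "x \<in> carrier R" using x H(1) subgroup.subset by fastforce
  interpret H: group "add_monoid R\<lparr>carrier := H\<rparr>"
    using add.subgroup_imp_group[OF H(1)] .
  have "x [^]\<^bsub>add_monoid R\<lparr>carrier := H\<rparr>\<^esub> order (add_monoid R\<lparr>carrier := H\<rparr>) = \<one>\<^bsub>add_monoid R\<lparr>carrier := H\<rparr>\<^esub>"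
    using H.pow_order_eq_1 x(1) by simp
  then have "[(p ^ 1)] \<cdot> x = \<zero>"
    using H(2) by (simp add: order_def add_pow_def nat_pow_def)
  with x xc show ?thesis by blast
qed

lemma (in ring) add_pow_card_zero:
  assumes "finite (carrier R)" "x \<in> carrier R"
  shows "[card (carrier R)] \<cdot> x = \<zero>"
  using add.pow_order_eq_1[OF _] assms by (simp add: order_def)

lemma (in ring) ring_char_pos_of_finite:
  assumes "finite (carrier R)"
  shows "ring_char R > 0"
  using ring_char_le(1)[OF add_pow_card_zero[OF assms one_closed]] assms
  by (metis card_gt_0_iff empty_iff one_closed)

text \<open>This replaces the characteristic of a finite ring by its cardinality, which is
  multiplicative over direct products.\<close>

lemma (in ring) prime_dvd_ring_char_iff:
  assumes fin: "finite (carrier R)" and p: "Factorial_Ring.prime p"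
  shows "p dvd ring_char R \<longleftrightarrow> p dvd card (carrier R)"
proof
  have pos: "ring_char R > 0" using ring_char_pos_of_finite[OF fin] .
  have ann: "[ring_char R] \<cdot> \<one> = \<zero>" using ring_char_annihilates[OF pos] .
  {
    assume "p dvd ring_char R"
    then obtain d where d: "ring_char R = p * d" by auto
    show "p dvd card (carrier R)"
    proof (rule ccontr)
      assume "\<not> p dvd card (carrier R)"
      then have co: "coprime p (card (carrier R))" using p prime_imp_coprime by blast
      have "[p] \<cdot> ([d] \<cdot> \<one>) = \<zero>"
        using add.nat_pow_pow[OF one_closed, of d p] add.nat_pow_pow[OF one_closed, of p d] ann d
        by (simp add: mult.commute)
      moreover have "[card (carrier R)] \<cdot> ([d] \<cdot> \<one>) = \<zero>"
        using add_pow_card_zero[OF fin] by simp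
      ultimately have "[d] \<cdot> \<one> = \<zero>"
        using add_pow_coprime_zero[OF _ _ _ co] by simp
      moreover have "d > 0" "d < ring_char R"
        using pos d prime_gt_1_nat[OF p] by auto
      ultimately show False using ring_char_le(2) by fastforce
    qed
  next
    assume dvd: "p dvd card (carrier R)"
    obtain x a where x: "x \<in> carrier R" "x \<noteq> \<zero>" "[(p ^ a)] \<cdot> x = \<zero>"
      using exists_prime_torsion[OF fin p dvd] by blast
    have "[ring_char R] \<cdot> x = \<zero>"
      using add_pow_one_mult[OF x(1), of "ring_char R"] ann x(1) by simp
    then have "\<not> coprime (p ^ a) (ring_char R)"
      using add_pow_coprime_zero[OF x(1,3)] x(2) by blast
    then show "p dvd ring_char R"
      using p prime_imp_coprime coprime_power_left_iff by blast
  }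
qed

section \<open>The admissible products\<close>

text \<open>\<open>unit_shape P n\<close>: the number \<open>n\<close> is a product of factors \<open>(p ^ l - 1) * p ^ (l * k)\<close> with
  \<open>l \<ge> 1\<close>, and \<open>P\<close> is exactly the set of the \<open>p\<close> that occur. Each factor is listed as a triple
  \<open>(p, l, k)\<close>; primality of the \<open>p\<close> is not part of the definition.\<close>

definition unit_shape :: "nat set \<Rightarrow> nat \<Rightarrow> bool" where
  "unit_shape P n \<longleftrightarrow> (\<exists>xs :: (nat \<times> nat \<times> nat) list.
     fst ` set xs = P \<and> (\<forall>(p, l, k)\<in>set xs. l \<ge> 1) \<and>
     n = (\<Prod>(p, l, k)\<leftarrow>xs. (p ^ l - 1) * p ^ (l * k)))"

lemma unit_shape_empty: "unit_shape {} 1"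
  unfolding unit_shape_def by (rule exI[of _ "[]"]) simp

lemma unit_shape_single:
  assumes "l \<ge> 1"
  shows "unit_shape {p} ((p ^ l - 1) * p ^ (l * k))"
  unfolding unit_shape_def using assms by (intro exI[of _ "[(p, l, k)]"]) simp

lemma unit_shape_mult:
  assumes "unit_shape P m" "unit_shape Q n"
  shows "unit_shape (P \<union> Q) (m * n)"
proof -
  obtain xs ys :: "(nat \<times> nat \<times> nat) list" where
    "fst ` set xs = P" "\<forall>(p, l, k)\<in>set xs. l \<ge> 1" "m = (\<Prod>(p, l, k)\<leftarrow>xs. (p ^ l - 1) * p ^ (l * k))"
    "fst ` set ys = Q" "\<forall>(p, l, k)\<in>set ys. l \<ge> 1" "n = (\<Prod>(p, l, k)\<leftarrow>ys. (p ^ l - 1) * p ^ (l * k))"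
    using assms unfolding unit_shape_def by blast
  then show ?thesis
    unfolding unit_shape_def by (intro exI[of _ "xs @ ys"]) (auto simp: image_Un)
qed

section \<open>Finite local rings\<close>

lemma card_eq_fibre_card_mult:
  assumes "finite A" "f ` A = B" "\<And>b. b \<in> B \<Longrightarrow> card {a \<in> A. f a = b} = c"
  shows "card A = c * card B"
proof -
  have "card A = (\<Sum>b\<in>B. \<Sum>a\<in>{a \<in> A. f a = b}. 1)"
    using sum.group[of A B f "\<lambda>_. 1::nat"] assms(1,2) by auto
  also have "\<dots> = (\<Sum>b\<in>B. c)" using assms(3) by (intro sum.cong) auto
  finally show ?thesis by simp
qed

lemma prime_power_if_unique_prime_factor:
  fixes n p :: nat
  assumes "Factorial_Ring.prime p" "n > 0"
    and "\<And>r. Factorial_Ring.prime r \<Longrightarrow> r dvd n \<Longrightarrow> r = p"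
  shows "\<exists>c. n = p ^ c"
proof -
  have "\<not> (\<exists>r\<in>prime_factors n. r \<noteq> p)"
    using assms(3) by (auto simp: in_prime_factors_iff)
  then show ?thesis
    using Ex_other_prime_factor[of n p] assms(1,2) by fastforce
qed

lemma (in monoid) exists_idempotent_power:
  assumes fin: "finite (carrier G)" and x: "x \<in> carrier G"
  shows "\<exists>n>0. (x [^] (n::nat)) \<otimes> (x [^] n) = x [^] n"
proof -
  \<comment> \<open>By finiteness the powers of x become periodic, with period d from exponent i on; a
    multiple of d that is at least i is the required exponent.\<close>
  have "\<not> inj (\<lambda>i::nat. x [^] i)"
  proof
    assume inj: "inj (\<lambda>i::nat. x [^] i)"
    have "range (\<lambda>i::nat. x [^] i) \<subseteq> carrier G" using x by auto
    then show False using finite_imageD[OF finite_subset[OF _ fin] inj] by simp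
  qed
  then obtain i j :: nat where "i \<noteq> j" "x [^] i = x [^] j" by (auto simp: inj_def)
  then obtain i d :: nat where d: "d > 0" "x [^] i = x [^] (i + d)"
    by (metis add_diff_inverse_nat less_imp_le linorder_neqE_nat not_less zero_less_diff)
  have step: "x [^] m = x [^] (m + d)" if "i \<le> m" for m
  proof -
    have "x [^] m = x [^] i \<otimes> x [^] (m - i)" using that x by (simp add: nat_pow_mult)
    also have "\<dots> = x [^] (i + d) \<otimes> x [^] (m - i)" using d by simp
    also have "\<dots> = x [^] (m + d)" using that x by (simp add: nat_pow_mult add.commute)
    finally show ?thesis .
  qed
  have steps: "x [^] m = x [^] (m + k * d)" if "i \<le> m" for m k
  proof (induction k)
    case (Suc k)
    then show ?case using step[of "m + k * d"] that by (simp add: algebra_simps)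
  qed simp
  define n where "n = Suc i * d"
  have "n > 0" "i \<le> n" using d by (auto simp: n_def intro: order.trans[of i "i * d"])
  have "x [^] n = x [^] (n + n)"
    using steps[OF \<open>i \<le> n\<close>, of "Suc i"] by (simp only: n_def)
  then have "x [^] n \<otimes> x [^] n = x [^] n"
    using nat_pow_mult[OF x, of n n] by metis
  then show ?thesis
    using \<open>n > 0\<close> by blast
qed

text \<open>Some power of \<open>x\<close> is idempotent, hence \<open>\<zero>\<close> or \<open>\<one>\<close>.\<close>

lemma (in cring) nilpotent_if_not_unit:
  assumes fin: "finite (carrier R)"
    and idem: "\<And>e. e \<in> carrier R \<Longrightarrow> e \<otimes> e = e \<Longrightarrow> e = \<zero> \<or> e = \<one>"
    and x: "x \<in> carrier R" "x \<notin> Units R"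
  shows "\<exists>n::nat. x [^] n = \<zero>"
proof -
  obtain n :: nat where n: "n > 0" "(x [^] n) \<otimes> (x [^] n) = x [^] n"
    using exists_idempotent_power[OF fin x(1)] by blast
  have "x [^] n \<noteq> \<one>"
  proof
    assume "x [^] n = \<one>"
    then have "x \<otimes> (x [^] (n - 1)) = \<one>"
      using nat_pow_mult[OF x(1), of 1 "n - 1"] n(1) x(1) by simp
    then have "x \<in> Units R"
      using x(1) by (auto simp: Units_def m_comm intro!: bexI[of _ "x [^] (n - 1)"])
    with x(2) show False by blast
  qed
  then show ?thesis using idem[of "x [^] n"] n x(1) by auto
qed

lemma (in cring) nilpotent_add_nilpotent_ne_one:
  assumes a: "a \<in> carrier R" "a [^] (m::nat) = \<zero>"
    and b: "b \<in> carrier R" "b [^] (n::nat) = \<zero>"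
    and ne: "\<one> \<noteq> \<zero>"
  shows "a \<oplus> b \<noteq> \<one>"
proof
  assume ab: "a \<oplus> b = \<one>"
  \<comment> \<open>The last nonzero power of a equals b times itself, hence vanishes because b is nilpotent.\<close>
  define k where "k = (LEAST k::nat. a [^] k = \<zero>)"
  have k: "a [^] k = \<zero>" unfolding k_def using a(2) by (rule LeastI)
  then have "k \<noteq> 0" using ne by (metis nat_pow_0)
  then obtain j where j: "k = Suc j" by (cases k) auto
  have nz: "a [^] j \<noteq> \<zero>"
    using not_less_Least[of j "\<lambda>k::nat. a [^] k = \<zero>"] j k_def by auto
  have absorb: "a [^] j = a [^] j \<otimes> b"
  proof -
    have "a [^] j = a [^] j \<otimes> (a \<oplus> b)" using ab a by simp
    also have "\<dots> = a [^] k \<oplus> a [^] j \<otimes> b" using a b j by (simp add: r_distr)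
    finally show ?thesis using k a b by simp
  qed
  have "a [^] j = a [^] j \<otimes> b [^] i" for i :: nat
  proof (induction i)
    case (Suc i)
    then show ?case using absorb a(1) b(1)
      by (metis m_assoc m_comm nat_pow_Suc nat_pow_closed)
  qed (use a in simp)
  from this[of n] show False using b a nz by simp
qed

lemma (in cring) unit_factor:
  assumes "x \<in> carrier R" "y \<in> carrier R" "x \<otimes> y \<in> Units R"
  shows "x \<in> Units R"
proof -
  have "x \<otimes> (y \<otimes> inv (x \<otimes> y)) = \<one>"
    using assms by (metis Units_inv_closed Units_r_inv m_assoc)
  moreover have "y \<otimes> inv (x \<otimes> y) \<in> carrier R" using assms by simp
  ultimately show ?thesis
    using assms(1) m_comm unfolding Units_def by fastforce
qed

lemma (in cring) nonunits_ideal: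
  assumes fin: "finite (carrier R)"
    and idem: "\<And>e. e \<in> carrier R \<Longrightarrow> e \<otimes> e = e \<Longrightarrow> e = \<zero> \<or> e = \<one>"
    and ne: "\<one> \<noteq> \<zero>"
  shows "ideal (carrier R - Units R) R"
proof -
  let ?M = "carrier R - Units R"
  have zero: "\<zero> \<in> ?M" using ne by (auto simp: Units_def)
  have absorb: "x \<otimes> a \<in> ?M" if "a \<in> ?M" "x \<in> carrier R" for a x
    using unit_factor[of a x] that by (auto simp: m_comm)
  have add: "a \<oplus> b \<in> ?M" if ab: "a \<in> ?M" "b \<in> ?M" for a b
  proof (rule ccontr)
    assume "a \<oplus> b \<notin> ?M"
    then have u: "a \<oplus> b \<in> Units R" using ab by auto
    define v where "v = inv (a \<oplus> b)"
    have v: "v \<in> carrier R" using u by (simp add: v_def)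
    have "v \<otimes> a \<oplus> v \<otimes> b = \<one>"
      using u v ab by (simp add: v_def r_distr[symmetric])
    moreover have "v \<otimes> a \<in> ?M" "v \<otimes> b \<in> ?M" using absorb ab v by auto
    ultimately show False
      using nilpotent_if_not_unit[OF fin idem] nilpotent_add_nilpotent_ne_one[OF _ _ _ _ ne]
      by (metis DiffE)
  qed
  have neg: "\<ominus> a \<in> ?M" if "a \<in> ?M" for a
    using absorb[OF that, of "\<ominus> \<one>"] that by (simp add: l_minus)
  have "subgroup ?M (add_monoid R)"
    using zero add neg by unfold_locales (auto simp: a_inv_def[symmetric])
  then show ?thesis
    using absorb by (intro idealI ring_axioms) (auto simp: m_comm)
qed

text \<open>Let \<open>M\<close> be the maximal ideal of a finite local ring and \<open>q\<close> the size of the residue field. Every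
  ideal has a composition series whose factors are isomorphic to the residue field, so its
  cardinality is a power of \<open>q\<close>. Instead of quotient modules, the proof counts the fibres of
  \<open>(n, r) \<mapsto> n \<oplus> r \<otimes> x\<close> on \<open>N' \<times> R\<close>, where \<open>N'\<close> is a maximal proper subideal of \<open>N\<close> and
  \<open>x \<in> N - N'\<close>: all fibres have \<open>card M\<close> elements.\<close>

lemma (in cring) local_ring_ideal_card:
  assumes fin: "finite (carrier R)" and M: "ideal (carrier R - Units R) R"
    and ne: "\<one> \<noteq> \<zero>"
    and q: "card (carrier R) = q * card (carrier R - Units R)"
  shows "ideal N R \<Longrightarrow> \<exists>k. card N = q ^ k"
proof (induction "card N" arbitrary: N rule: less_induct)
  case less
  let ?M = "carrier R - Units R"
  interpret M: ideal ?M R by (rule M)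
  interpret N: ideal N R by (rule less.prems)
  have finN: "finite N" using fin finite_subset[OF N.a_subset] by blast
  show ?case
  proof (cases "N = {\<zero>}")
    case True
    then show ?thesis by (intro exI[of _ 0]) simp
  next
    case False
    let ?A = "{I. ideal I R \<and> I \<subset> N}"
    have "finite ?A" by (rule finite_subset[of _ "Pow N"]) (use finN in auto)
    moreover have "{\<zero>} \<in> ?A"
      using zeroideal False N.zero_closed by blast
    ultimately obtain N' where N': "N' \<in> ?A" and max: "\<And>I. I \<in> ?A \<Longrightarrow> N' \<subseteq> I \<Longrightarrow> N' = I"
      using finite_has_maximal2[of ?A "{\<zero>}"] by metis
    interpret N': ideal N' R using N' by blast
    have sub: "N' \<subset> N" using N' by blast
    then obtain x where x: "x \<in> N" "x \<notin> N'" by blast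
    have xc: "x \<in> carrier R" using x N.a_subset by blast
    \<comment> \<open>By maximality of N', any element outside N' generates N together with N'.\<close>
    have gen: "\<exists>n\<in>N'. \<exists>r\<in>carrier R. z = n \<oplus> r \<otimes> y" if y: "y \<in> N" "y \<notin> N'" and z: "z \<in> N" for y z
    proof -
      have yc: "y \<in> carrier R" using y N.a_subset by blast
      define J where "J = N' <+>\<^bsub>R\<^esub> (PIdl y)"
      have J: "ideal J R"
        unfolding J_def using add_ideals[OF N'.ideal_axioms cgenideal_ideal[OF yc]] .
      have Jeq: "J = {n \<oplus> r \<otimes> y | n r. n \<in> N' \<and> r \<in> carrier R}"
        unfolding J_def by (auto simp: set_add_def' cgenideal_def)
      have "y = \<zero> \<oplus> \<one> \<otimes> y" using yc by simp
      then have yJ: "y \<in> J"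
        unfolding Jeq using N'.zero_closed one_closed by blast
      have "n \<in> J" if "n \<in> N'" for n
      proof -
        have "n = n \<oplus> \<zero> \<otimes> y" using yc N'.a_Hcarr[OF that] by simp
        then show ?thesis unfolding Jeq using that zero_closed by blast
      qed
      moreover have "z' \<in> N" if z': "z' \<in> J" for z'
      proof -
        obtain n r where "n \<in> N'" "r \<in> carrier R" "z' = n \<oplus> r \<otimes> y"
          using z' unfolding Jeq by blast
        then show ?thesis using sub N.I_l_closed[OF y(1)] N.a_closed by blast
      qed
      ultimately have "N' \<subseteq> J" "J \<subseteq> N" by blast+
      then have "J = N" using max[of J] J y yJ by blast
      then show ?thesis using z unfolding Jeq by blast
    qed
    \<comment> \<open>The annihilator of x modulo N' is M. A unit does not annihilate x; and if r in M did not,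
      then x would be n + s r x with n in N', so (1 - s r) x = n with 1 - s r a unit, placing x in N'.\<close>
    have iff: "r \<otimes> x \<in> N' \<longleftrightarrow> r \<in> ?M" if r: "r \<in> carrier R" for r
    proof
      assume rx: "r \<otimes> x \<in> N'"
      show "r \<in> ?M"
      proof (rule ccontr)
        assume "r \<notin> ?M"
        then have u: "r \<in> Units R" using r by blast
        then have "x = inv r \<otimes> (r \<otimes> x)" using xc r by (simp add: m_assoc[symmetric])
        then show False using N'.I_l_closed[OF rx, of "inv r"] u x by auto
      qed
    next
      assume rM: "r \<in> ?M"
      show "r \<otimes> x \<in> N'"
      proof (rule ccontr)
        assume "r \<otimes> x \<notin> N'"
        then obtain n s where ns: "n \<in> N'" "s \<in> carrier R" "x = n \<oplus> s \<otimes> (r \<otimes> x)"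
          using gen[of "r \<otimes> x" x] N.I_l_closed[OF x(1) r] x by blast
        have nc: "n \<in> carrier R" using ns N'.a_subset by blast
        have sr: "s \<otimes> r \<in> ?M" using M.I_l_closed rM ns by blast
        have "\<one> \<ominus> s \<otimes> r \<in> Units R"
        proof (rule ccontr)
          assume "\<one> \<ominus> s \<otimes> r \<notin> Units R"
          then have "(\<one> \<ominus> s \<otimes> r) \<oplus> s \<otimes> r \<in> ?M"
            using sr r ns(2) by (intro M.a_closed) auto
          moreover have "(\<one> \<ominus> s \<otimes> r) \<oplus> s \<otimes> r = \<one>" using r ns(2) by algebra
          ultimately show False by simp
        qed
        moreover have "(\<one> \<ominus> s \<otimes> r) \<otimes> x = n"
        proof -
          have "(\<one> \<ominus> s \<otimes> r) \<otimes> x = x \<ominus> s \<otimes> (r \<otimes> x)" using r ns(2) xc by algebra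
          also have "\<dots> = (n \<oplus> s \<otimes> (r \<otimes> x)) \<ominus> s \<otimes> (r \<otimes> x)" using ns(3) by simp
          also have "\<dots> = n" using r ns(2) nc xc by algebra
          finally show ?thesis .
        qed
        moreover have "x = inv (\<one> \<ominus> s \<otimes> r) \<otimes> ((\<one> \<ominus> s \<otimes> r) \<otimes> x)"
          using calculation(1) xc r ns(2) by (simp add: m_assoc[symmetric])
        ultimately have "x \<in> N'" using N'.I_l_closed[OF ns(1)] by (metis Units_inv_closed)
        then show False using x by blast
      qed
    qed
    let ?f = "\<lambda>(n, r). n \<oplus> r \<otimes> x"
    have img: "?f ` (N' \<times> carrier R) = N"
    proof
      show "?f ` (N' \<times> carrier R) \<subseteq> N"
      proof
        fix z assume "z \<in> ?f ` (N' \<times> carrier R)"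
        then obtain n r where "n \<in> N'" "r \<in> carrier R" "z = n \<oplus> r \<otimes> x" by auto
        then show "z \<in> N" using sub N.I_l_closed[OF x(1)] N.a_closed by blast
      qed
      show "N \<subseteq> ?f ` (N' \<times> carrier R)"
      proof
        fix z assume "z \<in> N"
        then obtain n r where nr: "n \<in> N'" "r \<in> carrier R" "z = n \<oplus> r \<otimes> x"
          using gen[OF x] by blast
        then have "(n, r) \<in> N' \<times> carrier R" "z = ?f (n, r)" by simp_all
        then show "z \<in> ?f ` (N' \<times> carrier R)" by blast
      qed
    qed
    have fib: "card {a \<in> N' \<times> carrier R. ?f a = y} = card ?M" if yN: "y \<in> N" for y
    proof -
      obtain n0 r0 where 0: "n0 \<in> N'" "r0 \<in> carrier R" "y = n0 \<oplus> r0 \<otimes> x"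
        using gen[OF x yN] by blast
      have n0c: "n0 \<in> carrier R" using 0 N'.a_subset by blast
      have yc: "y \<in> carrier R" using 0 n0c xc by simp
      have "bij_betw (\<lambda>m. (n0 \<ominus> m \<otimes> x, r0 \<oplus> m)) ?M {a \<in> N' \<times> carrier R. ?f a = y}"
      proof (rule bij_betw_byWitness[where f' = "\<lambda>(n, r). r \<ominus> r0"])
        show "\<forall>m\<in>?M. (case (n0 \<ominus> m \<otimes> x, r0 \<oplus> m) of (n, r) \<Rightarrow> r \<ominus> r0) = m"
        proof
          fix m assume m: "m \<in> ?M"
          then have mc: "m \<in> carrier R" by blast
          have "(r0 \<oplus> m) \<ominus> r0 = m" using mc 0(2) by algebra
          then show "(case (n0 \<ominus> m \<otimes> x, r0 \<oplus> m) of (n, r) \<Rightarrow> r \<ominus> r0) = m" by simp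
        qed
        have key: "r \<ominus> r0 \<in> ?M \<and> n0 \<ominus> (r \<ominus> r0) \<otimes> x = n \<and> r0 \<oplus> (r \<ominus> r0) = r"
          if nr: "n \<in> N'" "r \<in> carrier R" "n \<oplus> r \<otimes> x = y" for n r
        proof -
          have nc: "n \<in> carrier R" using nr N'.a_subset by blast
          have "(r \<ominus> r0) \<otimes> x = (n \<oplus> r \<otimes> x) \<ominus> n \<ominus> r0 \<otimes> x" using nr(2) 0(2) xc nc by algebra
          also have "\<dots> = (n0 \<oplus> r0 \<otimes> x) \<ominus> n \<ominus> r0 \<otimes> x" using nr(3) 0(3) by simp
          also have "\<dots> = n0 \<ominus> n" using 0(2) n0c nc xc by algebra
          finally have eq: "(r \<ominus> r0) \<otimes> x = n0 \<ominus> n" .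
          then have "(r \<ominus> r0) \<otimes> x \<in> N'"
            using nr(1) 0(1) by (simp add: a_minus_def)
          then have "r \<ominus> r0 \<in> ?M" using iff[of "r \<ominus> r0"] nr(2) 0(2) by simp
          moreover have "n0 \<ominus> (r \<ominus> r0) \<otimes> x = n" unfolding eq using n0c nc by algebra
          moreover have "r0 \<oplus> (r \<ominus> r0) = r" using nr(2) 0(2) by algebra
          ultimately show ?thesis by blast
        qed
        then show "\<forall>a\<in>{a \<in> N' \<times> carrier R. ?f a = y}.
            (\<lambda>m. (n0 \<ominus> m \<otimes> x, r0 \<oplus> m)) (case a of (n, r) \<Rightarrow> r \<ominus> r0) = a"
          by auto
        show "(\<lambda>(n, r). r \<ominus> r0) ` {a \<in> N' \<times> carrier R. ?f a = y} \<subseteq> ?M"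
          using key by auto
        show "(\<lambda>m. (n0 \<ominus> m \<otimes> x, r0 \<oplus> m)) ` ?M \<subseteq> {a \<in> N' \<times> carrier R. ?f a = y}"
        proof
          fix a assume "a \<in> (\<lambda>m. (n0 \<ominus> m \<otimes> x, r0 \<oplus> m)) ` ?M"
          then obtain m where m: "m \<in> ?M" "a = (n0 \<ominus> m \<otimes> x, r0 \<oplus> m)" by blast
          have mc: "m \<in> carrier R" using m by blast
          have "m \<otimes> x \<in> N'" using iff mc m by blast
          then have "n0 \<ominus> m \<otimes> x \<in> N'" using 0(1) by (simp add: a_minus_def)
          moreover have "(n0 \<ominus> m \<otimes> x) \<oplus> (r0 \<oplus> m) \<otimes> x = n0 \<oplus> r0 \<otimes> x"
            using mc 0(2) n0c xc by algebra
          ultimately show "a \<in> {a \<in> N' \<times> carrier R. ?f a = y}"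
            using m mc 0 by simp
        qed
      qed
      then show ?thesis by (simp add: bij_betw_same_card)
    qed
    have "card (N' \<times> carrier R) = card ?M * card N"
      using card_eq_fibre_card_mult[OF _ img fib] fin finite_subset[OF N'.a_subset] by simp
    then have "card N' * (q * card ?M) = card ?M * card N"
      using q by (simp add: card_cartesian_product)
    moreover have "card ?M > 0" using M.zero_closed fin by (auto simp: card_gt_0_iff)
    ultimately have "card N = q * card N'" by (simp add: mult.commute mult.left_commute)
    moreover obtain k where "card N' = q ^ k"
      using less.hyps[of N'] N' psubset_card_mono[OF finN sub] by blast
    ultimately show ?thesis by (intro exI[of _ "Suc k"]) simp
  qed
qed

lemma (in cring) add_pow_one_pow:
  "([(u::nat)] \<cdot> \<one>) [^] (n::nat) = [(u ^ n)] \<cdot> \<one>"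
proof (induction n)
  case (Suc n)
  then show ?case
    using add_pow_one_mult[of "[u] \<cdot> \<one>" "u ^ n"] add.nat_pow_pow[OF one_closed, of u "u ^ n"]
    by (simp add: mult.commute add.nat_pow_pow)
qed simp

text \<open>For a prime \<open>r\<close> dividing the order, some multiple \<open>[r ^ a] \<cdot> \<one>\<close> is a zero divisor, hence
  nilpotent, so \<open>\<one>\<close> is annihilated by a power of \<open>r\<close>. This cannot happen for two distinct primes.\<close>

lemma (in cring) local_ring_card_prime_power:
  assumes fin: "finite (carrier R)" and ne: "\<one> \<noteq> \<zero>"
    and nil: "\<And>x. x \<in> carrier R \<Longrightarrow> x \<notin> Units R \<Longrightarrow> \<exists>n::nat. x [^] n = \<zero>"
  shows "\<exists>p c. Factorial_Ring.prime (p::nat) \<and> card (carrier R) = p ^ c"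
proof -
  have nilp: "\<exists>n. [(r ^ n)] \<cdot> \<one> = \<zero>" if r: "Factorial_Ring.prime (r::nat)" "r dvd card (carrier R)" for r
  proof -
    obtain x a where x: "x \<in> carrier R" "x \<noteq> \<zero>" "[(r ^ a)] \<cdot> x = \<zero>"
      using exists_prime_torsion[OF fin r] by blast
    have "[(r ^ a)] \<cdot> \<one> \<notin> Units R"
    proof
      assume u: "[(r ^ a)] \<cdot> \<one> \<in> Units R"
      have "([(r ^ a)] \<cdot> \<one>) \<otimes> x = ([(r ^ a)] \<cdot> \<one>) \<otimes> \<zero>"
        using x u by (simp add: add_pow_one_mult)
      then show False using Units_l_cancel[OF u x(1) zero_closed] x(2) by blast
    qed
    then obtain n :: nat where "([(r ^ a)] \<cdot> \<one>) [^] n = \<zero>" using nil by fastforce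
    then show ?thesis by (auto simp: add_pow_one_pow power_mult[symmetric])
  qed
  have "card (carrier R) > 1"
    using ne card_le_Suc0_iff_eq[OF fin] by (metis One_nat_def not_less one_closed zero_closed)
  then obtain p where p: "Factorial_Ring.prime p" "p dvd card (carrier R)"
    using prime_factor_nat[of "card (carrier R)"] by auto
  have "r = p" if r: "Factorial_Ring.prime r" "r dvd card (carrier R)" for r
  proof (rule ccontr)
    assume "r \<noteq> p"
    then have "coprime (r ^ a) (p ^ b)" for a b
      using primes_coprime[OF r(1) p(1)] by simp
    moreover obtain a b where "[(r ^ a)] \<cdot> \<one> = \<zero>" "[(p ^ b)] \<cdot> \<one> = \<zero>"
      using nilp p r by blast
    ultimately show False using add_pow_coprime_zero[OF one_closed] ne by blast
  qed
  then have "\<exists>c. card (carrier R) = p ^ c"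
    using prime_power_if_unique_prime_factor[OF p(1)] \<open>card (carrier R) > 1\<close> by simp
  with p show ?thesis by blast
qed

lemma (in cring) local_ring_unit_shape:
  assumes fin: "finite (carrier R)"
    and idem: "\<And>e. e \<in> carrier R \<Longrightarrow> e \<otimes> e = e \<Longrightarrow> e = \<zero> \<or> e = \<one>"
    and ne: "\<one> \<noteq> \<zero>"
  shows "unit_shape {p. Factorial_Ring.prime p \<and> p dvd card (carrier R)} (card (Units R))"
proof -
  let ?M = "carrier R - Units R"
  have M: "ideal ?M R" using nonunits_ideal[OF fin idem ne] .
  obtain p c where p: "Factorial_Ring.prime (p::nat)" "card (carrier R) = p ^ c"
    using local_ring_card_prime_power[OF fin ne nilpotent_if_not_unit[OF fin idem]] by blast
  \<comment> \<open>q is the order of the residue field; the order of the ring is q ^ (k + 1) and that of the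
    group of units is q ^ (k + 1) - q ^ k.\<close>
  define q where "q = card (a_rcosets ?M)"
  have q: "card (carrier R) = q * card ?M"
    using a_lagrange[OF fin ideal.axioms(1)[OF M]] unfolding order_def q_def by (rule sym)
  have "\<exists>k. card ?M = q ^ k" by (rule local_ring_ideal_card[OF fin M ne q M])
  then obtain k where k: "card ?M = q ^ k" by blast
  have "q dvd p ^ c" unfolding p(2)[symmetric] q by (rule dvd_triv_left)
  then have "\<exists>i\<le>c. q = p ^ i" by (rule iffD1[OF divides_primepow_nat[OF p(1)]])
  then obtain l where l: "q = p ^ l" by blast
  have Usub: "Units R \<subseteq> carrier R" by (auto simp: Units_def)
  have U: "card ?M = card (carrier R) - card (Units R)"
    using card_Diff_subset[OF finite_subset[OF Usub fin] Usub] .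
  have Ule: "card (Units R) \<le> card (carrier R)"
    using card_mono[OF fin Usub] .
  have Upos: "card (Units R) > 0"
    using finite_subset[OF Usub fin] Units_one_closed by (metis card_gt_0_iff empty_iff)
  have "l \<ge> 1"
  proof (rule ccontr)
    assume "\<not> l \<ge> 1"
    then have "q = 1" using l by simp
    then have "card (carrier R) = card ?M" using q by (metis mult_1)
    then show False using U Ule Upos by linarith
  qed
  have R: "card (carrier R) = q * q ^ k" using q unfolding k .
  then have "card (carrier R) = p ^ (l * Suc k)"
    unfolding l by (simp add: power_add power_mult)
  then have primes: "{r. Factorial_Ring.prime r \<and> r dvd card (carrier R)} = {p}"
    using p(1) \<open>l \<ge> 1\<close> by (auto simp: prime_dvd_power_nat_iff dest: primes_dvd_imp_eq)
  have "card (Units R) = (p ^ l - 1) * p ^ (l * k)"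
  proof -
    have "card (Units R) = q * q ^ k - q ^ k" using U Ule unfolding R k by linarith
    then show ?thesis unfolding l by (simp add: diff_mult_distrib power_mult)
  qed
  then show ?thesis unfolding primes using unit_shape_single[OF \<open>l \<ge> 1\<close>] by simp
qed

section \<open>Finite commutative rings\<close>

text \<open>The corner ring \<open>e R\<close> of an idempotent \<open>e\<close>, with unit element \<open>e\<close>. Its carrier is written as the
  set of fixed points of multiplication by \<open>e\<close>, which equals \<open>e R\<close> because \<open>e\<close> is idempotent.\<close>

definition corner :: "('a, 'b) ring_scheme \<Rightarrow> 'a \<Rightarrow> ('a, 'b) ring_scheme" where
  "corner R e = R\<lparr>carrier := {x \<in> carrier R. e \<otimes>\<^bsub>R\<^esub> x = x}, one := e\<rparr>"

lemma corner_simps [simp]: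
  "carrier (corner R e) = {x \<in> carrier R. e \<otimes>\<^bsub>R\<^esub> x = x}"
  "\<one>\<^bsub>corner R e\<^esub> = e" "\<zero>\<^bsub>corner R e\<^esub> = \<zero>\<^bsub>R\<^esub>"
  "add (corner R e) = add R" "monoid.mult (corner R e) = monoid.mult R"
  by (simp_all add: corner_def)

lemma (in cring) corner_cring:
  assumes e: "e \<in> carrier R" "e \<otimes> e = e"
  shows "cring (corner R e)"
proof (intro cringI abelian_groupI comm_monoidI)
  show "\<exists>y\<in>carrier (corner R e). y \<oplus>\<^bsub>corner R e\<^esub> x = \<zero>\<^bsub>corner R e\<^esub>"
    if "x \<in> carrier (corner R e)" for x
  proof -
    have x: "x \<in> carrier R" "e \<otimes> x = x" using that by auto
    then have "e \<otimes> (\<ominus> x) = \<ominus> x" using e by (simp add: r_minus)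
    then show ?thesis
      using x by (intro bexI[of _ "\<ominus> x"]) (auto simp: l_neg)
  qed
  show "x \<otimes>\<^bsub>corner R e\<^esub> y \<in> carrier (corner R e)"
    if "x \<in> carrier (corner R e)" "y \<in> carrier (corner R e)" for x y
    using that e by (simp add: m_assoc[symmetric])
qed (use e in \<open>simp_all add: a_assoc m_assoc l_distr r_distr a_comm m_comm a_lcomm m_lcomm\<close>)

lemma (in cring) complement_idempotent:
  assumes e: "e \<in> carrier R" "e \<otimes> e = e"
  shows "(\<one> \<ominus> e) \<otimes> (\<one> \<ominus> e) = \<one> \<ominus> e"
proof -
  have "(\<one> \<ominus> e) \<otimes> (\<one> \<ominus> e) = \<one> \<ominus> e \<ominus> e \<oplus> e \<otimes> e" using e(1) by algebra
  also have "\<dots> = \<one> \<ominus> e" unfolding e(2) using e(1) by algebra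
  finally show ?thesis .
qed

text \<open>The Peirce decomposition \<open>R = e R \<times> (1 - e) R\<close>, for elements and for units.\<close>

lemma (in cring) corner_decomp:
  assumes e: "e \<in> carrier R" "e \<otimes> e = e"
  shows "bij_betw (\<lambda>x. (e \<otimes> x, (\<one> \<ominus> e) \<otimes> x)) (carrier R)
           (carrier (corner R e) \<times> carrier (corner R (\<one> \<ominus> e)))" (is ?carr)
    and "bij_betw (\<lambda>x. (e \<otimes> x, (\<one> \<ominus> e) \<otimes> x)) (Units R)
           (Units (corner R e) \<times> Units (corner R (\<one> \<ominus> e)))" (is ?units)
proof -
  define f where "f = \<one> \<ominus> e"
  have f: "f \<in> carrier R" using e by (simp add: f_def)
  have ff: "f \<otimes> f = f" unfolding f_def by (rule complement_idempotent[OF e])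
  have ef: "e \<otimes> f = \<zero>"
  proof -
    have "e \<otimes> f = e \<ominus> e \<otimes> e" unfolding f_def using e(1) by algebra
    then show ?thesis using e by (simp add: a_minus_def r_neg)
  qed
  have e1f: "e \<oplus> f = \<one>" unfolding f_def using e(1) by algebra
  have sum: "e \<otimes> x \<oplus> f \<otimes> x = x" if "x \<in> carrier R" for x
    using that e f e1f by (simp add: l_distr[symmetric])
  have proj_e: "e \<otimes> (a \<oplus> b) = a" if "a \<in> carrier R" "e \<otimes> a = a" "b \<in> carrier R" "f \<otimes> b = b" for a b
  proof -
    have "e \<otimes> b = \<zero>" using that e f ef by (metis l_null m_assoc)
    then show ?thesis using that e by (simp add: r_distr)
  qed
  have proj_f: "f \<otimes> (a \<oplus> b) = b" if "a \<in> carrier R" "e \<otimes> a = a" "b \<in> carrier R" "f \<otimes> b = b" for a b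
  proof -
    have "f \<otimes> a = \<zero>" using that e f ef by (metis l_null m_assoc m_comm)
    then show ?thesis using that f by (simp add: r_distr)
  qed
  have ee: "e \<otimes> (e \<otimes> x) = e \<otimes> x" "f \<otimes> (f \<otimes> x) = f \<otimes> x" if "x \<in> carrier R" for x
    using that e f ff by (simp_all add: m_assoc[symmetric])
  show ?carr unfolding f_def[symmetric]
    by (rule bij_betw_byWitness[where f' = "\<lambda>(a, b). a \<oplus> b"])
      (use e f sum proj_e proj_f ee in auto)
  show ?units unfolding f_def[symmetric]
  proof (rule bij_betw_byWitness[where f' = "\<lambda>(a, b). a \<oplus> b"])
    show "\<forall>a\<in>Units R. (case (e \<otimes> a, f \<otimes> a) of (a, b) \<Rightarrow> a \<oplus> b) = a"
      using sum by auto
    show "\<forall>a'\<in>Units (corner R e) \<times> Units (corner R f).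
        (\<lambda>x. (e \<otimes> x, f \<otimes> x)) (case a' of (a, b) \<Rightarrow> a \<oplus> b) = a'"
      using proj_e proj_f by (auto simp: Units_def)
    have prod: "(g \<otimes> x) \<otimes> (g \<otimes> y) = g"
      if "g \<in> carrier R" "g \<otimes> g = g" "x \<in> carrier R" "y \<in> carrier R" "x \<otimes> y = \<one>" for g x y
    proof -
      have "(g \<otimes> x) \<otimes> (g \<otimes> y) = (g \<otimes> g) \<otimes> (x \<otimes> y)" using that(1,3,4) by algebra
      then show ?thesis using that by simp
    qed
    show "(\<lambda>x. (e \<otimes> x, f \<otimes> x)) ` Units R \<subseteq> Units (corner R e) \<times> Units (corner R f)"
    proof
      fix z assume "z \<in> (\<lambda>x. (e \<otimes> x, f \<otimes> x)) ` Units R"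
      then obtain x where x: "x \<in> Units R" "z = (e \<otimes> x, f \<otimes> x)" by blast
      then obtain y where y: "y \<in> carrier R" "x \<otimes> y = \<one>" "y \<otimes> x = \<one>" and xc: "x \<in> carrier R"
        by (auto simp: Units_def)
      have "e \<otimes> x \<in> Units (corner R e)"
        unfolding Units_def using prod[OF e] y xc ee(1) e
        by (auto intro!: bexI[of _ "e \<otimes> y"])
      moreover have "f \<otimes> x \<in> Units (corner R f)"
        unfolding Units_def using prod[OF f ff] y xc ee(2) f
        by (auto intro!: bexI[of _ "f \<otimes> y"])
      ultimately show "z \<in> Units (corner R e) \<times> Units (corner R f)" using x by blast
    qed
    show "(\<lambda>(a, b). a \<oplus> b) ` (Units (corner R e) \<times> Units (corner R f)) \<subseteq> Units R"
    proof clarify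
      fix a b assume "a \<in> Units (corner R e)" "b \<in> Units (corner R f)"
      then obtain a' b' where a: "a \<in> carrier R" "e \<otimes> a = a" "a' \<in> carrier R" "e \<otimes> a' = a'" "a \<otimes> a' = e"
        and b: "b \<in> carrier R" "f \<otimes> b = b" "b' \<in> carrier R" "f \<otimes> b' = b'" "b \<otimes> b' = f"
        by (auto simp: Units_def)
      have orth: "x \<otimes> y = \<zero>" if "x \<in> carrier R" "e \<otimes> x = x" "y \<in> carrier R" "f \<otimes> y = y" for x y
      proof -
        have "x \<otimes> y = (e \<otimes> x) \<otimes> (f \<otimes> y)" using that by simp
        also have "\<dots> = (e \<otimes> f) \<otimes> (x \<otimes> y)" using that(1,3) e(1) f by algebra
        finally show ?thesis using ef that by simp
      qed
      have "(a \<oplus> b) \<otimes> (a' \<oplus> b') = a \<otimes> a' \<oplus> a \<otimes> b' \<oplus> (a' \<otimes> b \<oplus> b \<otimes> b')"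
        using a(1,3) b(1,3) by algebra
      also have "\<dots> = \<one>" using orth[of a b'] orth[of a' b] a b e f e1f by simp
      finally show "a \<oplus> b \<in> Units R"
        using a b by (auto simp: Units_def m_comm intro!: bexI[of _ "a' \<oplus> b'"])
    qed
  qed
qed

text \<open>Splitting off idempotents reduces the claim to the local case by induction on the cardinality.\<close>

theorem finite_cring_unit_shape:
  fixes R :: "('a, 'b) ring_scheme"
  assumes "cring R" "finite (carrier R)"
  shows "unit_shape {p. Factorial_Ring.prime p \<and> p dvd card (carrier R)} (card (Units R))"
  using assms
proof (induction "card (carrier R)" arbitrary: R rule: less_induct)
  case (less R)
  interpret cring R by (rule less.prems)
  note fin = less.prems(2)
  consider "\<one>\<^bsub>R\<^esub> = \<zero>\<^bsub>R\<^esub>"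
    | "\<one>\<^bsub>R\<^esub> \<noteq> \<zero>\<^bsub>R\<^esub>" "\<And>e. e \<in> carrier R \<Longrightarrow> e \<otimes>\<^bsub>R\<^esub> e = e \<Longrightarrow> e = \<zero>\<^bsub>R\<^esub> \<or> e = \<one>\<^bsub>R\<^esub>"
    | e where "e \<in> carrier R" "e \<otimes>\<^bsub>R\<^esub> e = e" "e \<noteq> \<zero>\<^bsub>R\<^esub>" "e \<noteq> \<one>\<^bsub>R\<^esub>" by blast
  then show ?case
  proof cases
    case 1
    then have c: "carrier R = {\<zero>\<^bsub>R\<^esub>}" using one_zeroD by blast
    have U: "Units R = {\<zero>\<^bsub>R\<^esub>}" using c 1 by (auto simp: Units_def)
    have P: "{p::nat. Factorial_Ring.prime p \<and> p dvd card (carrier R)} = {}"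
      unfolding c by auto
    show ?thesis unfolding U P using unit_shape_empty by simp
  next
    case 2
    then show ?thesis using local_ring_unit_shape[OF fin] by blast
  next
    case (3 e)
    define f where "f = \<one>\<^bsub>R\<^esub> \<ominus>\<^bsub>R\<^esub> e"
    have f: "f \<in> carrier R" using 3 by (simp add: f_def)
    have ff: "f \<otimes>\<^bsub>R\<^esub> f = f" unfolding f_def by (rule complement_idempotent[OF 3(1,2)])
    have "f \<noteq> \<one>\<^bsub>R\<^esub>"
    proof
      assume "f = \<one>\<^bsub>R\<^esub>"
      have "e = \<one>\<^bsub>R\<^esub> \<ominus>\<^bsub>R\<^esub> f" unfolding f_def using 3(1) by algebra
      then show False using \<open>f = \<one>\<^bsub>R\<^esub>\<close> 3(3) by (simp add: a_minus_def r_neg)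
    qed
    have smaller: "card (carrier (corner R g)) < card (carrier R)"
      if "g \<in> carrier R" "g \<noteq> \<one>\<^bsub>R\<^esub>" for g
    proof (intro psubset_card_mono fin psubsetI)
      show "carrier (corner R g) \<noteq> carrier R"
      proof
        assume "carrier (corner R g) = carrier R"
        then have "\<one>\<^bsub>R\<^esub> \<in> carrier (corner R g)" using one_closed by (simp only:)
        then show False using that by simp
      qed
    qed auto
    have "finite (carrier (corner R g))" for g using fin by simp
    then have IH: "unit_shape {p. Factorial_Ring.prime p \<and> p dvd card (carrier (corner R g))} (card (Units (corner R g)))"
      if "g \<in> carrier R" "g \<otimes>\<^bsub>R\<^esub> g = g" "g \<noteq> \<one>\<^bsub>R\<^esub>" for g
      using less.hyps[OF smaller corner_cring] that by blast
    have "card (carrier R) = card (carrier (corner R e)) * card (carrier (corner R f))"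
      using bij_betw_same_card[OF corner_decomp(1)[OF 3(1,2)]]
      unfolding card_cartesian_product f_def .
    then have "{p. Factorial_Ring.prime p \<and> p dvd card (carrier R)} =
        {p. Factorial_Ring.prime p \<and> p dvd card (carrier (corner R e))} \<union>
        {p. Factorial_Ring.prime p \<and> p dvd card (carrier (corner R f))}"
      by (auto simp: prime_dvd_mult_iff)
    moreover have "card (Units R) = card (Units (corner R e)) * card (Units (corner R f))"
      using bij_betw_same_card[OF corner_decomp(2)[OF 3(1,2)]]
      unfolding card_cartesian_product f_def .
    ultimately show ?thesis
      using unit_shape_mult[OF IH[OF 3(1,2,4)] IH[OF f ff \<open>f \<noteq> \<one>\<^bsub>R\<^esub>\<close>]] by simp
  qed
qed

section \<open>The subring generated by the units\<close>

text \<open>The additive span of the group of units: all finite sums of units. Since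
  \<open>\<ominus> \<one>\<close> is a unit, it is closed under negation, and it is the subring generated by the units.\<close>

inductive_set unit_span :: "('a, 'b) ring_scheme \<Rightarrow> 'a set" for R (structure) where
  zero: "\<zero> \<in> unit_span R"
| add: "u \<in> Units R \<Longrightarrow> x \<in> unit_span R \<Longrightarrow> u \<oplus> x \<in> unit_span R"

context ring
begin

lemma unit_span_closed: "x \<in> unit_span R \<Longrightarrow> x \<in> carrier R"
  by (induction rule: unit_span.induct) auto

lemma Units_subset_unit_span: "Units R \<subseteq> unit_span R"
proof
  fix u assume u: "u \<in> Units R"
  then have "u \<oplus> \<zero> \<in> unit_span R" by (intro unit_span.intros)
  then show "u \<in> unit_span R" using u by (simp add: Units_closed)
qed

lemma unit_span_add:
  assumes "x \<in> unit_span R" "y \<in> unit_span R"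
  shows "x \<oplus> y \<in> unit_span R"
  using assms(1)
proof induction
  case zero
  then show ?case using assms(2) unit_span_closed by simp
next
  case (add u x)
  have "u \<oplus> (x \<oplus> y) \<in> unit_span R" by (rule unit_span.add[OF add.hyps(1) add.IH])
  then show ?case using add assms(2) by (simp add: a_assoc Units_closed unit_span_closed)
qed

lemma unit_span_unit_mult:
  assumes "u \<in> Units R" "x \<in> unit_span R"
  shows "u \<otimes> x \<in> unit_span R"
  using assms(2)
proof induction
  case zero
  then show ?case using assms(1) by (simp add: Units_closed unit_span.zero)
next
  case (add v x)
  have "u \<otimes> v \<oplus> u \<otimes> x \<in> unit_span R" using add assms(1) by (intro unit_span.intros) auto
  then show ?case using add assms(1) by (simp add: r_distr Units_closed unit_span_closed)
qed

lemma unit_span_mult: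
  assumes "x \<in> unit_span R" "y \<in> unit_span R"
  shows "x \<otimes> y \<in> unit_span R"
  using assms(1)
proof induction
  case zero
  then show ?case using assms(2) by (simp add: unit_span_closed unit_span.zero)
next
  case (add u x)
  have "u \<otimes> y \<oplus> x \<otimes> y \<in> unit_span R"
    by (rule unit_span_add[OF unit_span_unit_mult[OF add.hyps(1) assms(2)] add.IH])
  then show ?case using add assms(2) by (simp add: l_distr Units_closed unit_span_closed)
qed

lemma minus_one_Unit: "\<ominus> \<one> \<in> Units R"
proof -
  have "\<ominus> \<one> \<otimes> \<ominus> \<one> = \<one>" by (simp add: l_minus r_minus)
  then show ?thesis unfolding Units_def by auto
qed

lemma unit_span_subring: "subring (unit_span R) R"
proof (rule subringI)
  show "\<ominus> x \<in> unit_span R" if "x \<in> unit_span R" for x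
    using unit_span_unit_mult[OF minus_one_Unit that] unit_span_closed[OF that] by (simp add: l_minus)
qed (use unit_span_closed Units_subset_unit_span unit_span_add unit_span_mult in auto)

lemma unit_span_commute:
  assumes comm: "\<And>u v. u \<in> Units R \<Longrightarrow> v \<in> Units R \<Longrightarrow> u \<otimes> v = v \<otimes> u"
    and "x \<in> unit_span R" "y \<in> unit_span R"
  shows "x \<otimes> y = y \<otimes> x"
proof -
  have unit: "u \<otimes> x = x \<otimes> u" if u: "u \<in> Units R" and x: "x \<in> unit_span R" for u x
    using x
  proof induction
    case zero
    then show ?case using u by (simp add: Units_closed)
  next
    case (add v x)
    then show ?case using u comm[OF u add(1)]
      by (simp add: l_distr r_distr Units_closed unit_span_closed)
  qed
  show ?thesis using assms(2)
  proof induction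
    case zero
    then show ?case using assms(3) by (simp add: unit_span_closed)
  next
    case (add u x)
    then show ?case using unit[OF add(1) assms(3)] assms(3)
      by (simp add: l_distr r_distr Units_closed unit_span_closed)
  qed
qed

lemma Units_unit_span: "Units (R\<lparr>carrier := unit_span R\<rparr>) = Units R"
proof
  show "Units (R\<lparr>carrier := unit_span R\<rparr>) \<subseteq> Units R"
    by (auto simp: Units_def dest: unit_span_closed)
  show "Units R \<subseteq> Units (R\<lparr>carrier := unit_span R\<rparr>)"
  proof
    fix u assume u: "u \<in> Units R"
    then have "inv u \<in> unit_span R" "u \<in> unit_span R" using Units_subset_unit_span by auto
    then show "u \<in> Units (R\<lparr>carrier := unit_span R\<rparr>)"
      using u unfolding Units_def[of "R\<lparr>carrier := unit_span R\<rparr>"]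
      by (auto intro!: bexI[of _ "inv u"])
  qed
qed

text \<open>A finitely generated subgroup of an abelian group of exponent \<open>m\<close> is finite; the formulation as a
  finite set closed under adding generators suffices and allows adjoining one generator at a time.\<close>

lemma exists_finite_add_closed:
  assumes m: "m > (0::nat)" "\<And>x. x \<in> carrier R \<Longrightarrow> [m] \<cdot> x = \<zero>"
    and V: "finite V" "V \<subseteq> carrier R"
  shows "\<exists>F. finite F \<and> F \<subseteq> carrier R \<and> \<zero> \<in> F \<and> (\<forall>v\<in>V. \<forall>x\<in>F. v \<oplus> x \<in> F)"
  using V
proof (induction V rule: finite_induct)
  case empty
  show ?case by (rule exI[of _ "{\<zero>}"]) simp
next
  case (insert v V)
  then obtain F where F: "finite F" "F \<subseteq> carrier R" "\<zero> \<in> F" "\<forall>v\<in>V. \<forall>x\<in>F. v \<oplus> x \<in> F"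
    by auto
  have v: "v \<in> carrier R" and Vc: "V \<subseteq> carrier R" using insert.prems by auto
  define F' where "F' = (\<lambda>(i::nat, x). [i] \<cdot> v \<oplus> x) ` ({..<m} \<times> F)"
  have mem: "[i] \<cdot> v \<oplus> x \<in> F'" if "x \<in> F" for i :: nat and x
  proof -
    have "[i] \<cdot> v = [(m * (i div m) + i mod m)] \<cdot> v" by simp
    also have "\<dots> = [(m * (i div m))] \<cdot> v \<oplus> [(i mod m)] \<cdot> v"
      using v by (simp add: add.nat_pow_mult)
    also have "[(m * (i div m))] \<cdot> v = [(i div m)] \<cdot> ([m] \<cdot> v)"
      using add.nat_pow_pow[OF v, of "i div m" m] by simp
    also have "\<dots> = \<zero>" using m(2)[OF v] by (simp add: add.nat_pow_eone)
    finally have "[i] \<cdot> v = [(i mod m)] \<cdot> v" using v by simp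
    then show ?thesis using that m(1) unfolding F'_def by (auto intro!: image_eqI[of _ _ "(i mod m, x)"])
  qed
  have closed: "w \<oplus> y \<in> F'" if w: "w \<in> insert v V" and y: "y \<in> F'" for w y
  proof -
    obtain i :: nat and x where x: "x \<in> F" "y = [i] \<cdot> v \<oplus> x" using y unfolding F'_def by auto
    have xc: "x \<in> carrier R" using x F(2) by blast
    show ?thesis
    proof (cases "w = v")
      case True
      have "w \<oplus> y = [(Suc i)] \<cdot> v \<oplus> x"
        using True x v xc by (simp add: a_assoc a_lcomm)
      then show ?thesis using mem[OF x(1), of "Suc i"] by (simp only:)
    next
      case False
      then have wV: "w \<in> V" using w by blast
      then have wc: "w \<in> carrier R" using Vc by blast
      have eq: "w \<oplus> y = [i] \<cdot> v \<oplus> (w \<oplus> x)" using x v xc wc by (simp add: a_lcomm)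
      have "w \<oplus> x \<in> F" using F(4) wV x(1) by blast
      then show ?thesis unfolding eq by (rule mem)
    qed
  qed
  have "finite F'" unfolding F'_def using F(1) by simp
  moreover have "F' \<subseteq> carrier R" unfolding F'_def using F(2) v by auto
  moreover have "\<zero> \<in> F'" using mem[OF F(3), of 0] by simp
  ultimately show ?case using closed by blast
qed

lemma finite_unit_span:
  assumes "ring_char R > 0" "finite (Units R)"
  shows "finite (unit_span R)"
proof -
  have ann: "[ring_char R] \<cdot> x = \<zero>" if "x \<in> carrier R" for x
  proof -
    have "[ring_char R] \<cdot> x = \<zero> \<otimes> x"
      using add_pow_one_mult[OF that, of "ring_char R"] unfolding ring_char_annihilates[OF assms(1)]
      by (rule sym)
    then show ?thesis using that by simp
  qed
  have Usub: "Units R \<subseteq> carrier R" using Units_closed by (rule subsetI)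
  obtain F where F: "finite F" "\<zero> \<in> F" "\<forall>v\<in>Units R. \<forall>x\<in>F. v \<oplus> x \<in> F"
    using exists_finite_add_closed[OF assms(1) ann assms(2) Usub] by blast
  have "x \<in> F" if "x \<in> unit_span R" for x
    using that
  proof induction
    case zero
    show ?case by (rule F(2))
  next
    case (add u x)
    then show ?case using F(3) by blast
  qed
  then have "unit_span R \<subseteq> F" by (rule subsetI)
  then show ?thesis using F(1) by (rule finite_subset)
qed

end

lemma ring_char_restrict: "ring_char (R\<lparr>carrier := H\<rparr>) = ring_char R"
proof -
  have "[m] \<cdot>\<^bsub>R\<lparr>carrier := H\<rparr>\<^esub> \<one>\<^bsub>R\<lparr>carrier := H\<rparr>\<^esub> = [m] \<cdot>\<^bsub>R\<^esub> \<one>\<^bsub>R\<^esub>" for m :: nat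
    by (simp add: add_pow_def nat_pow_def)
  then have "([m] \<cdot>\<^bsub>R\<lparr>carrier := H\<rparr>\<^esub> \<one>\<^bsub>R\<lparr>carrier := H\<rparr>\<^esub> = \<zero>\<^bsub>R\<lparr>carrier := H\<rparr>\<^esub>) =
      ([m] \<cdot>\<^bsub>R\<^esub> \<one>\<^bsub>R\<^esub> = \<zero>\<^bsub>R\<^esub>)" for m :: nat
    by simp
  then show ?thesis unfolding ring_char_def by (simp only:)
qed

section \<open>Finite fields\<close>

lemma (in ring_hom_ring) hom_add_pow_nat:
  assumes "x \<in> carrier R"
  shows "h (add_pow R (n::nat) x) = add_pow S n (h x)"
  using assms by (induction n) (simp_all add: R.add.nat_pow_Suc S.add.nat_pow_Suc)

context cring
begin

lemma binomial:
  assumes a: "a \<in> carrier R" and b: "b \<in> carrier R"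
  shows "(a \<oplus> b) [^] n = (\<Oplus>i\<in>{..n}. [(n choose i)] \<cdot> (a [^] i \<otimes> b [^] (n - i)))"
proof (induction n)
  case 0
  show ?case using a b by simp
next
  case (Suc n)
  have choose0: "(Suc n choose 0) = (n choose 0)" by simp
  let ?t = "\<lambda>i. a [^] i \<otimes> b [^] (Suc n - i)"
  let ?s = "\<lambda>i. [(n choose i)] \<cdot> (a [^] i \<otimes> b [^] (n - i))"
  let ?S = "\<Oplus>i\<in>{..n}. ?s i"
  have t: "?t i \<in> carrier R" for i using a b by simp
  have ct: "[k] \<cdot> ?t i \<in> carrier R" for i and k :: nat by (rule add.nat_pow_closed[OF t])
  have s: "?s i \<in> carrier R" for i using a b by simp
  have "(\<Oplus>i\<in>{..Suc n}. [(Suc n choose i)] \<cdot> ?t i) =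
      (\<Oplus>i\<in>{..n}. [(Suc n choose Suc i)] \<cdot> ?t (Suc i)) \<oplus> [(Suc n choose 0)] \<cdot> ?t 0"
    by (intro finsum_Suc2 Pi_I ct)
  also have "(\<Oplus>i\<in>{..n}. [(Suc n choose Suc i)] \<cdot> ?t (Suc i)) =
      (\<Oplus>i\<in>{..n}. [(n choose i)] \<cdot> ?t (Suc i) \<oplus> [(n choose Suc i)] \<cdot> ?t (Suc i))"
  proof (rule finsum_cong')
    show "(\<lambda>i. [(n choose i)] \<cdot> ?t (Suc i) \<oplus> [(n choose Suc i)] \<cdot> ?t (Suc i)) \<in> {..n} \<rightarrow> carrier R"
      by (intro Pi_I a_closed ct)
    show "[(Suc n choose Suc i)] \<cdot> ?t (Suc i) =
        [(n choose i)] \<cdot> ?t (Suc i) \<oplus> [(n choose Suc i)] \<cdot> ?t (Suc i)" for i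
      unfolding binomial_Suc_Suc by (rule add.nat_pow_mult[OF t, symmetric])
  qed simp
  also have "\<dots> = (\<Oplus>i\<in>{..n}. [(n choose i)] \<cdot> ?t (Suc i)) \<oplus> (\<Oplus>i\<in>{..n}. [(n choose Suc i)] \<cdot> ?t (Suc i))"
    by (intro finsum_addf Pi_I ct)
  also have "(\<Oplus>i\<in>{..n}. [(n choose i)] \<cdot> ?t (Suc i)) = ?S \<otimes> a"
  proof -
    have "?S \<otimes> a = (\<Oplus>i\<in>{..n}. ?s i \<otimes> a)" using s a by (intro finsum_ldistr) auto
    also have "\<dots> = (\<Oplus>i\<in>{..n}. [(n choose i)] \<cdot> ?t (Suc i))"
    proof (rule finsum_cong')
      fix i
      have "?s i \<otimes> a = [(n choose i)] \<cdot> ((a [^] i \<otimes> b [^] (n - i)) \<otimes> a)"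
        using a b by (simp add: add_pow_ldistr)
      also have "(a [^] i \<otimes> b [^] (n - i)) \<otimes> a = ?t (Suc i)"
        using a b by (simp add: m_assoc m_comm m_lcomm)
      finally show "?s i \<otimes> a = [(n choose i)] \<cdot> ?t (Suc i)" .
    qed (simp, intro Pi_I ct)
    finally show ?thesis by simp
  qed
  also have "(?S \<otimes> a \<oplus> (\<Oplus>i\<in>{..n}. [(n choose Suc i)] \<cdot> ?t (Suc i))) \<oplus> [(Suc n choose 0)] \<cdot> ?t 0 =
      ?S \<otimes> a \<oplus> ((\<Oplus>i\<in>{..n}. [(n choose Suc i)] \<cdot> ?t (Suc i)) \<oplus> [(n choose 0)] \<cdot> ?t 0)"
    unfolding choose0
    by (rule a_assoc[OF m_closed[OF finsum_closed a] finsum_closed ct]) (intro Pi_I s ct)+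
  also have "(\<Oplus>i\<in>{..n}. [(n choose Suc i)] \<cdot> ?t (Suc i)) \<oplus> [(n choose 0)] \<cdot> ?t 0 =
      (\<Oplus>i\<in>{..Suc n}. [(n choose i)] \<cdot> ?t i)"
    by (intro finsum_Suc2[symmetric] Pi_I ct)
  also have "\<dots> = [(n choose Suc n)] \<cdot> ?t (Suc n) \<oplus> (\<Oplus>i\<in>{..n}. [(n choose i)] \<cdot> ?t i)"
    by (intro finsum_Suc Pi_I ct)
  also have "\<dots> = (\<Oplus>i\<in>{..n}. [(n choose i)] \<cdot> ?t i)"
    using t by (simp add: binomial_eq_0 finsum_closed)
  also have "\<dots> = ?S \<otimes> b"
  proof -
    have "?S \<otimes> b = (\<Oplus>i\<in>{..n}. ?s i \<otimes> b)" using s b by (intro finsum_ldistr) auto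
    also have "\<dots> = (\<Oplus>i\<in>{..n}. [(n choose i)] \<cdot> ?t i)"
    proof (rule finsum_cong')
      fix i assume "i \<in> {..n}"
      then have "Suc n - i = Suc (n - i)" by auto
      then show "?s i \<otimes> b = [(n choose i)] \<cdot> ?t i"
        using a b by (simp add: add_pow_ldistr m_assoc)
    qed (simp, intro Pi_I ct)
    finally show ?thesis by simp
  qed
  also have "?S \<otimes> a \<oplus> ?S \<otimes> b = ?S \<otimes> (a \<oplus> b)"
    using s a b by (simp add: r_distr finsum_closed)
  also have "\<dots> = (a \<oplus> b) [^] Suc n"
    unfolding Suc.IH[symmetric] by simp
  finally show ?case by simp
qed

text \<open>The Frobenius map is additive: the inner binomial coefficients are divisible by \<open>p\<close>.\<close>

lemma frobenius_add:
  assumes p: "Factorial_Ring.prime (p::nat)" and char: "[p] \<cdot> \<one> = \<zero>"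
    and a: "a \<in> carrier R" and b: "b \<in> carrier R"
  shows "(a \<oplus> b) [^] p = a [^] p \<oplus> b [^] p"
proof -
  have pzero: "[(p * m)] \<cdot> x = \<zero>" if "x \<in> carrier R" for m :: nat and x
  proof -
    have "[p] \<cdot> x = \<zero> \<otimes> x" using add_pow_one_mult[OF that, of p] unfolding char by (rule sym)
    then have "[m] \<cdot> ([p] \<cdot> x) = \<zero>" using that by (simp add: add.nat_pow_eone)
    then show ?thesis using add.nat_pow_pow[OF that, of m p] by simp
  qed
  let ?f = "\<lambda>i. [(p choose i)] \<cdot> (a [^] i \<otimes> b [^] (p - i))"
  have f: "?f i \<in> carrier R" for i using a b by simp
  obtain k where k: "p = Suc (Suc k)"
    using prime_ge_2_nat[OF p] by (metis add_2_eq_Suc le_Suc_ex)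
  have "(\<Oplus>i\<in>{..k}. ?f (Suc i)) = \<zero>"
  proof (rule add.finprod_one_eqI[simplified])
    fix i assume "i \<in> {..k}"
    then have "p dvd (p choose Suc i)"
      using p k by (intro dvd_choose_prime) auto
    then obtain m where "(p choose Suc i) = p * m" by (rule dvdE)
    then show "?f (Suc i) = \<zero>" using pzero[of "a [^] Suc i \<otimes> b [^] (p - Suc i)" m] a b by simp
  qed
  moreover have "(\<Oplus>i\<in>{..Suc k}. ?f i) = (\<Oplus>i\<in>{..k}. ?f (Suc i)) \<oplus> ?f 0"
    by (intro finsum_Suc2 Pi_I f)
  moreover have "(\<Oplus>i\<in>{..Suc (Suc k)}. ?f i) = ?f (Suc (Suc k)) \<oplus> (\<Oplus>i\<in>{..Suc k}. ?f i)"
    by (intro finsum_Suc Pi_I f)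
  ultimately have "(\<Oplus>i\<in>{..Suc (Suc k)}. ?f i) = ?f (Suc (Suc k)) \<oplus> (\<zero> \<oplus> ?f 0)"
    by (simp only:)
  then have "(\<Oplus>i\<in>{..p}. ?f i) = ?f p \<oplus> (\<zero> \<oplus> ?f 0)"
    unfolding k[symmetric] .
  then show ?thesis unfolding binomial[OF a b] using a b by simp
qed

lemma frobenius_pow_add:
  assumes p: "Factorial_Ring.prime (p::nat)" and char: "[p] \<cdot> \<one> = \<zero>"
    and a: "a \<in> carrier R" and b: "b \<in> carrier R"
  shows "(a \<oplus> b) [^] (p ^ l) = a [^] (p ^ l) \<oplus> b [^] (p ^ l)"
proof (induction l)
  case 0
  show ?case using a b by simp
next
  case (Suc l)
  have step: "x [^] (p ^ Suc l) = (x [^] (p ^ l)) [^] p" if "x \<in> carrier R" for x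
    using that by (simp add: nat_pow_pow mult.commute)
  show ?case
    using Suc frobenius_add[OF p char, of "a [^] (p ^ l)" "b [^] (p ^ l)"] a b
    by (simp only: step a_closed nat_pow_closed)
qed

lemma frobenius_pow_minus:
  assumes p: "Factorial_Ring.prime (p::nat)" and char: "[p] \<cdot> \<one> = \<zero>"
    and a: "a \<in> carrier R"
  shows "(\<ominus> a) [^] (p ^ l) = \<ominus> (a [^] (p ^ l))"
proof -
  have "p ^ l \<noteq> 0" using prime_gt_0_nat[OF p] by simp
  then have "\<zero> [^] (p ^ l) = \<zero>" by (simp add: nat_pow_zero)
  then have "(\<ominus> a) [^] (p ^ l) \<oplus> a [^] (p ^ l) = \<zero>"
    using frobenius_pow_add[OF p char, of "\<ominus> a" a l] a by (simp add: l_neg)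
  then show ?thesis using a by (simp add: minus_equality)
qed

end

lemma (in field) frobenius_fixed_subfield:
  assumes p: "Factorial_Ring.prime (p::nat)" and char: "[p] \<cdot> \<one> = \<zero>"
  shows "subfield {a \<in> carrier R. a [^] (p ^ l) = a} R" (is "subfield ?K R")
proof (rule subfieldI', rule subringI)
  show "?K \<subseteq> carrier R" "\<one> \<in> ?K" by auto
  show "\<ominus> a \<in> ?K" if "a \<in> ?K" for a
    using that frobenius_pow_minus[OF p char, of a l] by simp
  show "a \<otimes> b \<in> ?K" if "a \<in> ?K" "b \<in> ?K" for a b
    using that by (simp add: nat_pow_distrib)
  show "a \<oplus> b \<in> ?K" if "a \<in> ?K" "b \<in> ?K" for a b
    using that frobenius_pow_add[OF p char, of a b l] by simp
  show "inv a \<in> ?K" if "a \<in> ?K - {\<zero>}" for a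
  proof -
    have a: "a \<in> Units R" "a \<in> carrier R" "a [^] (p ^ l) = a" using that field_Units by auto
    have inv: "inv a [^] (p ^ l) \<in> carrier R" using a(1) by simp
    have "a \<otimes> inv a [^] (p ^ l) = (a \<otimes> inv a) [^] (p ^ l)"
      using a(2,3) nat_pow_distrib[OF a(2) Units_inv_closed[OF a(1)], of "p ^ l"] by argo
    also have "\<dots> = \<one>" using a(1) by simp
    finally have "inv a [^] (p ^ l) = inv a"
      using comm_inv_char[OF a(2) inv] by simp
    then show ?thesis using a(1) by simp
  qed
qed

text \<open>The fixed points of \<open>a \<mapsto> a ^ q\<close> are the roots of \<open>X ^ q - X\<close>, which splits; it remains to see that
  its roots are simple. For a root \<open>a\<close> and \<open>D = X - a\<close>, additivity of the Frobenius map gives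
  \<open>X ^ q - X = D ^ q - D = D (D ^ (q - 1) - 1)\<close>, whose second factor does not vanish at \<open>a\<close>.\<close>

lemma (in algebraically_closed) card_frobenius_fixed:
  assumes p: "Factorial_Ring.prime (p::nat)" and char: "[p] \<cdot> \<one> = \<zero>" and l: "l \<ge> 1"
  shows "finite {a \<in> carrier L. a [^] (p ^ l) = a}" "card {a \<in> carrier L. a [^] (p ^ l) = a} = p ^ l"
proof -
  define q where "q = p ^ l"
  have q2: "q \<ge> 2" using self_le_power[of p l] prime_ge_2_nat[OF p] l by (simp add: q_def)
  let ?P = "poly_ring L"
  interpret UP: domain ?P using univ_poly_is_domain[OF carrier_is_subring] .
  have const_hom: "ring_hom_ring L ?P poly_of_const"
    using canonical_embedding_ring_hom[OF carrier_is_subring] by simp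
  interpret C: ring_hom_ring L ?P poly_of_const by (rule const_hom)
  have charP: "add_pow ?P p \<one>\<^bsub>?P\<^esub> = \<zero>\<^bsub>?P\<^esub>"
    using C.hom_add_pow_nat[OF one_closed, of p] char by simp
  define Q where "Q = X [^]\<^bsub>?P\<^esub> q \<ominus>\<^bsub>?P\<^esub> X"
  have X: "X \<in> carrier ?P" using var_closed(1)[OF carrier_is_subring] .
  have Q: "Q \<in> carrier ?P" unfolding Q_def using X by simp
  have ev_hom: "ring_hom_ring ?P L (\<lambda>f. eval f a)" if "a \<in> carrier L" for a
    using eval_ring_hom[OF carrier_is_subring that] .
  have evX: "eval X a = a" if "a \<in> carrier L" for a using eval_var[OF that] .
  have ev_pow: "eval (f [^]\<^bsub>?P\<^esub> (n::nat)) a = (eval f a) [^] n" if "a \<in> carrier L" "f \<in> carrier ?P" for a f n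
    using ring_hom_ring.hom_nat_pow[OF ev_hom[OF that(1)] that(2)] .
  have degQ: "degree Q = q"
  proof -
    have d1: "degree (X [^]\<^bsub>?P\<^esub> q) = q"
      using polynomial_pow_degree[OF X, of q] by (simp add: var_def)
    have d2: "degree (\<ominus>\<^bsub>?P\<^esub> X) = 1"
      using univ_poly_a_inv_degree[OF carrier_is_subring X] by (simp add: var_def)
    have "polynomial (carrier L) (X [^]\<^bsub>?P\<^esub> q)" "polynomial (carrier L) (\<ominus>\<^bsub>?P\<^esub> X)"
      using X unfolding univ_poly_carrier by auto
    then have "degree (poly_add (X [^]\<^bsub>?P\<^esub> q) (\<ominus>\<^bsub>?P\<^esub> X)) = q"
      using poly_add_degree_eq[OF carrier_is_subring] d1 d2 q2 by simp
    then show ?thesis unfolding Q_def a_minus_def univ_poly_add .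
  qed
  have Qnz: "Q \<noteq> []" using degQ q2 by auto
  have evQ: "eval Q a = a [^] q \<ominus> a" if a: "a \<in> carrier L" for a
  proof -
    interpret E: ring_hom_ring ?P L "\<lambda>f. eval f a" by (rule ev_hom[OF a])
    show ?thesis unfolding Q_def a_minus_def using X evX[OF a] ev_pow[OF a X] by simp
  qed
  have root: "is_root Q a \<longleftrightarrow> a \<in> carrier L \<and> a [^] q = a" for a
  proof (cases "a \<in> carrier L")
    case True
    then have "a [^] q \<ominus> a = \<zero> \<longleftrightarrow> a [^] q = a" by (intro r_right_minus_eq) auto
    then show ?thesis unfolding is_root_def evQ[OF True] using Qnz True by blast
  qed (simp add: is_root_def)
  have mult1: "alg_mult Q a = 1" if a: "is_root Q a" for a
  proof -
    have ac: "a \<in> carrier L" and aq: "a [^] q = a" using a root by auto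
    define D where "D = [\<one>, \<ominus> a]"
    define c where "c = poly_of_const (\<ominus> a)"
    have c: "c \<in> carrier ?P" unfolding c_def using ac by simp
    have D: "D \<in> carrier ?P"
      unfolding D_def using ac unfolding sym[OF univ_poly_carrier] polynomial_def by auto
    have Dsum: "D = X \<oplus>\<^bsub>?P\<^esub> c"
      unfolding D_def c_def var_def poly_of_const_def univ_poly_add using ac by auto
    have cq: "c [^]\<^bsub>?P\<^esub> q = c"
    proof -
      have "(\<ominus> a) [^] q = \<ominus> a" using frobenius_pow_minus[OF p char ac, of l] aq by (simp add: q_def)
      then show ?thesis unfolding c_def using C.hom_nat_pow[of "\<ominus> a" q] ac by simp
    qed
    have "D [^]\<^bsub>?P\<^esub> q = X [^]\<^bsub>?P\<^esub> q \<oplus>\<^bsub>?P\<^esub> c"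
      using UP.frobenius_pow_add[OF p charP X c, of l] cq unfolding Dsum q_def by simp
    then have "D [^]\<^bsub>?P\<^esub> q \<ominus>\<^bsub>?P\<^esub> D = (X [^]\<^bsub>?P\<^esub> q \<oplus>\<^bsub>?P\<^esub> c) \<ominus>\<^bsub>?P\<^esub> (X \<oplus>\<^bsub>?P\<^esub> c)" unfolding Dsum by simp
    also have "\<dots> = Q"
    proof -
      have "X [^]\<^bsub>?P\<^esub> q \<in> carrier ?P" using X by simp
      then show ?thesis unfolding Q_def using X c by algebra
    qed
    finally have QD: "Q = D [^]\<^bsub>?P\<^esub> q \<ominus>\<^bsub>?P\<^esub> D" by simp
    have "\<not> 2 \<le> alg_mult Q a"
    proof
      assume "2 \<le> alg_mult Q a"
      then have "(D [^]\<^bsub>?P\<^esub> (2::nat)) pdivides Q"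
        using le_alg_mult_imp_pdivides[OF ac Q] unfolding D_def by blast
      then obtain s where s: "s \<in> carrier ?P" "Q = D [^]\<^bsub>?P\<^esub> (2::nat) \<otimes>\<^bsub>?P\<^esub> s"
        unfolding pdivides_def factor_def by blast
      obtain r where r: "q = Suc (Suc r)" using q2 by (metis add_2_eq_Suc le_Suc_ex)
      have "D \<otimes>\<^bsub>?P\<^esub> (D [^]\<^bsub>?P\<^esub> (Suc r) \<ominus>\<^bsub>?P\<^esub> \<one>\<^bsub>?P\<^esub>) = Q"
      proof -
        have "D [^]\<^bsub>?P\<^esub> q = D [^]\<^bsub>?P\<^esub> Suc r \<otimes>\<^bsub>?P\<^esub> D" unfolding r by simp
        moreover have "D [^]\<^bsub>?P\<^esub> Suc r \<in> carrier ?P" using D by blast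
        moreover have "D \<otimes>\<^bsub>?P\<^esub> (e \<ominus>\<^bsub>?P\<^esub> \<one>\<^bsub>?P\<^esub>) = e \<otimes>\<^bsub>?P\<^esub> D \<ominus>\<^bsub>?P\<^esub> D"
          if "e \<in> carrier ?P" for e
          using D that by (simp add: a_minus_def UP.r_distr UP.r_minus UP.m_comm)
        ultimately show ?thesis unfolding QD by (simp only:)
      qed
      also have "Q = D \<otimes>\<^bsub>?P\<^esub> (D \<otimes>\<^bsub>?P\<^esub> s)"
        using s D by (simp add: UP.m_assoc numeral_2_eq_2)
      finally have "D [^]\<^bsub>?P\<^esub> (Suc r) \<ominus>\<^bsub>?P\<^esub> \<one>\<^bsub>?P\<^esub> = D \<otimes>\<^bsub>?P\<^esub> s"
        using UP.m_lcancel[of D "D [^]\<^bsub>?P\<^esub> (Suc r) \<ominus>\<^bsub>?P\<^esub> \<one>\<^bsub>?P\<^esub>" "D \<otimes>\<^bsub>?P\<^esub> s"] D s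
        by (simp add: univ_poly_zero D_def)
      then have "eval (D [^]\<^bsub>?P\<^esub> (Suc r) \<ominus>\<^bsub>?P\<^esub> \<one>\<^bsub>?P\<^esub>) a = eval (D \<otimes>\<^bsub>?P\<^esub> s) a" by simp
      moreover have evD: "eval D a = \<zero>" unfolding D_def using ac by (simp add: r_neg)
      interpret E: ring_hom_ring ?P L "\<lambda>f. eval f a" by (rule ev_hom[OF ac])
      have "eval (D [^]\<^bsub>?P\<^esub> (Suc r) \<ominus>\<^bsub>?P\<^esub> \<one>\<^bsub>?P\<^esub>) a = \<ominus> \<one>"
        unfolding a_minus_def using E.hom_add[of "D [^]\<^bsub>?P\<^esub> (Suc r)" "\<ominus>\<^bsub>?P\<^esub> \<one>\<^bsub>?P\<^esub>"] E.hom_nat_pow[OF D, of "Suc r"] evD D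
        by simp
      moreover have "eval (D \<otimes>\<^bsub>?P\<^esub> s) a = \<zero>" using E.hom_mult[OF D s(1)] evD s(1) by simp
      ultimately have "\<ominus> \<one> = \<zero>" by simp
      then show False using one_not_zero by (metis minus_minus minus_zero one_closed)
    qed
    moreover have "alg_mult Q a > 0" using alg_mult_gt_zero_iff_is_root[OF Q] a by simp
    ultimately show ?thesis by simp
  qed
  have set: "set_mset (roots Q) = {a \<in> carrier L. a [^] q = a}"
    using roots_mem_iff_is_root[OF Q] root by auto
  have "size (roots Q) = q" using roots_over_carrier[OF Q] degQ unfolding splitted_def by simp
  moreover have "size (roots Q) = (\<Sum>a\<in>set_mset (roots Q). count (roots Q) a)"
    by (rule size_multiset_overloaded_eq)
  moreover have "\<dots> = (\<Sum>a\<in>set_mset (roots Q). 1)"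
    using mult1 roots_mem_iff_is_root[OF Q] alg_mult_eq_count_roots[OF Q]
    by (intro sum.cong) auto
  ultimately have "card (set_mset (roots Q)) = q" by simp
  then show "card {a \<in> carrier L. a [^] (p ^ l) = a} = p ^ l" unfolding set q_def .
  show "finite {a \<in> carrier L. a [^] (p ^ l) = a}"
    using finite_set_mset[of "roots Q"] unfolding set q_def .
qed

theorem exists_finite_field:
  assumes p: "Factorial_Ring.prime (p::nat)" and l: "l \<ge> 1"
  shows "\<exists>F :: ((int list \<times> nat) multiset \<Rightarrow> int) ring.
    field F \<and> finite (carrier F) \<and> card (carrier F) = p ^ l"
proof -
  interpret Z: residues_prime p "residue_ring (int p)" using p by unfold_locales simp_all
  interpret Z: field "residue_ring (int p)" by (rule Z.is_field)
  let ?L = "Z.alg_closure"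
  interpret L: algebraic_closure ?L "Z.indexed_const ` carrier (residue_ring (int p))"
    by (rule Z.alg_closureE(1))
  interpret H: ring_hom_ring "residue_ring (int p)" ?L Z.indexed_const
    using Z.alg_closureE(2) Z.ring_axioms L.ring_axioms by (intro ring_hom_ringI2)
  have "add_pow (residue_ring (int p)) p \<one>\<^bsub>residue_ring (int p)\<^esub> = \<zero>\<^bsub>residue_ring (int p)\<^esub>"
    using Z.add_pow_card_zero[of "\<one>\<^bsub>residue_ring (int p)\<^esub>"] Z.res_carrier_eq Z.one_closed Z.finite
    by (simp del: Z.one_closed)
  then have char: "add_pow ?L p \<one>\<^bsub>?L\<^esub> = \<zero>\<^bsub>?L\<^esub>"
    using H.hom_add_pow_nat[OF Z.one_closed, of p] by simp
  let ?K = "{a \<in> carrier ?L. a [^]\<^bsub>?L\<^esub> (p ^ l) = a}"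
  have "field (?L\<lparr>carrier := ?K\<rparr>)"
    using L.subfield_iff(2)[OF L.frobenius_fixed_subfield[OF p char]] .
  then show ?thesis
    using L.card_frobenius_fixed[OF p char l] by (intro exI[of _ "?L\<lparr>carrier := ?K\<rparr>"]) simp
qed

section \<open>Trivial extensions, direct products and transport\<close>

text \<open>The trivial extension \<open>F \<ltimes> F ^ k\<close>, that is \<open>F[X\<^sub>1, \<dots>, X\<^sub>k] / (X\<^sub>1, \<dots>, X\<^sub>k)\<^sup>2\<close>. An element is a
  function on \<open>{..k}\<close> whose value at \<open>0\<close> is the component in \<open>F\<close>; products of two components
  with positive index vanish.\<close>

definition triv_ext :: "('a, 'b) ring_scheme \<Rightarrow> nat \<Rightarrow> (nat \<Rightarrow> 'a) ring" where
  "triv_ext F k =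
     \<lparr>carrier = {..k} \<rightarrow>\<^sub>E carrier F,
      monoid.mult = (\<lambda>f g. \<lambda>i\<in>{..k}. if i = 0 then f 0 \<otimes>\<^bsub>F\<^esub> g 0
        else f 0 \<otimes>\<^bsub>F\<^esub> g i \<oplus>\<^bsub>F\<^esub> f i \<otimes>\<^bsub>F\<^esub> g 0),
      one = (\<lambda>i\<in>{..k}. if i = 0 then \<one>\<^bsub>F\<^esub> else \<zero>\<^bsub>F\<^esub>),
      ring.zero = (\<lambda>i\<in>{..k}. \<zero>\<^bsub>F\<^esub>),
      add = (\<lambda>f g. \<lambda>i\<in>{..k}. f i \<oplus>\<^bsub>F\<^esub> g i)\<rparr>"

lemma triv_ext_simps [simp]:
  "carrier (triv_ext F k) = {..k} \<rightarrow>\<^sub>E carrier F"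
  "f \<otimes>\<^bsub>triv_ext F k\<^esub> g = (\<lambda>i\<in>{..k}. if i = 0 then f 0 \<otimes>\<^bsub>F\<^esub> g 0
        else f 0 \<otimes>\<^bsub>F\<^esub> g i \<oplus>\<^bsub>F\<^esub> f i \<otimes>\<^bsub>F\<^esub> g 0)"
  "\<one>\<^bsub>triv_ext F k\<^esub> = (\<lambda>i\<in>{..k}. if i = 0 then \<one>\<^bsub>F\<^esub> else \<zero>\<^bsub>F\<^esub>)"
  "\<zero>\<^bsub>triv_ext F k\<^esub> = (\<lambda>i\<in>{..k}. \<zero>\<^bsub>F\<^esub>)"
  "f \<oplus>\<^bsub>triv_ext F k\<^esub> g = (\<lambda>i\<in>{..k}. f i \<oplus>\<^bsub>F\<^esub> g i)"
  by (simp_all add: triv_ext_def)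

context cring
begin

lemma triv_ext_mem:
  assumes "f \<in> carrier (triv_ext R k)" "i \<le> k"
  shows "f i \<in> carrier R"
  using assms by auto

lemma triv_ext_eqI:
  assumes "f \<in> carrier (triv_ext R k)" "g \<in> carrier (triv_ext R k)" "\<And>i. i \<le> k \<Longrightarrow> f i = g i"
  shows "f = g"
  using assms by (intro PiE_ext[of f "{..k}" "\<lambda>_. carrier R" g]) auto

lemma triv_ext_add_closed:
  assumes "f \<in> carrier (triv_ext R k)" "g \<in> carrier (triv_ext R k)"
  shows "f \<oplus>\<^bsub>triv_ext R k\<^esub> g \<in> carrier (triv_ext R k)"
  using triv_ext_mem[OF assms(1)] triv_ext_mem[OF assms(2)] by simp

lemma triv_ext_mult_closed:
  assumes "f \<in> carrier (triv_ext R k)" "g \<in> carrier (triv_ext R k)"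
  shows "f \<otimes>\<^bsub>triv_ext R k\<^esub> g \<in> carrier (triv_ext R k)"
  using triv_ext_mem[OF assms(1)] triv_ext_mem[OF assms(2)] by simp

lemma triv_ext_cring: "cring (triv_ext R k)"
proof (intro cringI abelian_groupI comm_monoidI)
  let ?T = "triv_ext R k"
  note mem = triv_ext_mem and addc = triv_ext_add_closed and mulc = triv_ext_mult_closed
  show zero: "\<zero>\<^bsub>?T\<^esub> \<in> carrier ?T" and one: "\<one>\<^bsub>?T\<^esub> \<in> carrier ?T" by simp_all
  fix x assume x: "x \<in> carrier ?T"
  show "\<zero>\<^bsub>?T\<^esub> \<oplus>\<^bsub>?T\<^esub> x = x"
    by (rule triv_ext_eqI[OF addc[OF zero x] x]) (use mem[OF x] in simp)
  show "\<one>\<^bsub>?T\<^esub> \<otimes>\<^bsub>?T\<^esub> x = x"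
    by (rule triv_ext_eqI[OF mulc[OF one x] x]) (use mem[OF x] in simp)
  have neg: "(\<lambda>i\<in>{..k}. \<ominus> x i) \<in> carrier ?T" using mem[OF x] by simp
  show "\<exists>y\<in>carrier ?T. y \<oplus>\<^bsub>?T\<^esub> x = \<zero>\<^bsub>?T\<^esub>"
  proof (rule bexI[OF _ neg])
    show "(\<lambda>i\<in>{..k}. \<ominus> x i) \<oplus>\<^bsub>?T\<^esub> x = \<zero>\<^bsub>?T\<^esub>"
      by (rule triv_ext_eqI[OF addc[OF neg x] zero]) (use mem[OF x] in \<open>simp add: l_neg\<close>)
  qed
  fix y assume y: "y \<in> carrier ?T"
  show "x \<oplus>\<^bsub>?T\<^esub> y \<in> carrier ?T" "x \<otimes>\<^bsub>?T\<^esub> y \<in> carrier ?T"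
    using addc[OF x y] mulc[OF x y] .
  show "x \<oplus>\<^bsub>?T\<^esub> y = y \<oplus>\<^bsub>?T\<^esub> x"
    by (rule triv_ext_eqI[OF addc[OF x y] addc[OF y x]])
      (use mem[OF x] mem[OF y] in \<open>simp add: a_comm\<close>)
  show "x \<otimes>\<^bsub>?T\<^esub> y = y \<otimes>\<^bsub>?T\<^esub> x"
    by (rule triv_ext_eqI[OF mulc[OF x y] mulc[OF y x]])
      (use mem[OF x] mem[OF y] in \<open>simp add: a_comm m_comm\<close>)
  fix z assume z: "z \<in> carrier ?T"
  show "x \<oplus>\<^bsub>?T\<^esub> y \<oplus>\<^bsub>?T\<^esub> z = x \<oplus>\<^bsub>?T\<^esub> (y \<oplus>\<^bsub>?T\<^esub> z)"
    by (rule triv_ext_eqI[OF addc[OF addc[OF x y] z] addc[OF x addc[OF y z]]])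
      (use mem[OF x] mem[OF y] mem[OF z] in \<open>simp add: a_assoc\<close>)
  show "x \<otimes>\<^bsub>?T\<^esub> y \<otimes>\<^bsub>?T\<^esub> z = x \<otimes>\<^bsub>?T\<^esub> (y \<otimes>\<^bsub>?T\<^esub> z)"
  proof (rule triv_ext_eqI[OF mulc[OF mulc[OF x y] z] mulc[OF x mulc[OF y z]]])
    fix i assume i: "i \<le> k"
    have c: "x 0 \<in> carrier R" "y 0 \<in> carrier R" "z 0 \<in> carrier R"
      "x i \<in> carrier R" "y i \<in> carrier R" "z i \<in> carrier R"
      using mem x y z i by blast+
    have "(x 0 \<otimes> y 0) \<otimes> z i \<oplus> (x 0 \<otimes> y i \<oplus> x i \<otimes> y 0) \<otimes> z 0 =
        x 0 \<otimes> (y 0 \<otimes> z i \<oplus> y i \<otimes> z 0) \<oplus> x i \<otimes> (y 0 \<otimes> z 0)"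
      using c by algebra
    then show "(x \<otimes>\<^bsub>?T\<^esub> y \<otimes>\<^bsub>?T\<^esub> z) i = (x \<otimes>\<^bsub>?T\<^esub> (y \<otimes>\<^bsub>?T\<^esub> z)) i"
      using c i by (simp add: m_assoc)
  qed
  show "(x \<oplus>\<^bsub>?T\<^esub> y) \<otimes>\<^bsub>?T\<^esub> z = x \<otimes>\<^bsub>?T\<^esub> z \<oplus>\<^bsub>?T\<^esub> y \<otimes>\<^bsub>?T\<^esub> z"
  proof (rule triv_ext_eqI[OF mulc[OF addc[OF x y] z] addc[OF mulc[OF x z] mulc[OF y z]]])
    fix i assume i: "i \<le> k"
    have c: "x 0 \<in> carrier R" "y 0 \<in> carrier R" "z 0 \<in> carrier R"
      "x i \<in> carrier R" "y i \<in> carrier R" "z i \<in> carrier R"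
      using mem x y z i by blast+
    have "(x 0 \<oplus> y 0) \<otimes> z i \<oplus> (x i \<oplus> y i) \<otimes> z 0 =
        (x 0 \<otimes> z i \<oplus> x i \<otimes> z 0) \<oplus> (y 0 \<otimes> z i \<oplus> y i \<otimes> z 0)"
      using c by algebra
    then show "((x \<oplus>\<^bsub>?T\<^esub> y) \<otimes>\<^bsub>?T\<^esub> z) i = (x \<otimes>\<^bsub>?T\<^esub> z \<oplus>\<^bsub>?T\<^esub> y \<otimes>\<^bsub>?T\<^esub> z) i"
      using c i by (simp add: l_distr)
  qed
qed

lemma Units_triv_ext:
  "Units (triv_ext R k) = (\<Pi>\<^sub>E i\<in>{..k}. if i = 0 then Units R else carrier R)"
proof
  let ?T = "triv_ext R k"
  interpret T: cring ?T by (rule triv_ext_cring)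
  show "Units ?T \<subseteq> (\<Pi>\<^sub>E i\<in>{..k}. if i = 0 then Units R else carrier R)"
  proof
    fix x assume "x \<in> Units ?T"
    then obtain y where x: "x \<in> carrier ?T" and y: "y \<in> carrier ?T" and xy: "x \<otimes>\<^bsub>?T\<^esub> y = \<one>\<^bsub>?T\<^esub>"
      by (auto simp: Units_def simp del: triv_ext_simps)
    have "x 0 \<otimes> y 0 = \<one>" using fun_cong[OF xy, of 0] by simp
    then have "x 0 \<in> Units R"
      using triv_ext_mem[OF x, of 0] triv_ext_mem[OF y, of 0] m_comm unfolding Units_def by force
    then show "x \<in> (\<Pi>\<^sub>E i\<in>{..k}. if i = 0 then Units R else carrier R)"
      using x by (auto simp: PiE_iff)
  qed
  show "(\<Pi>\<^sub>E i\<in>{..k}. if i = 0 then Units R else carrier R) \<subseteq> Units ?T"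
  proof
    fix x assume x': "x \<in> (\<Pi>\<^sub>E i\<in>{..k}. if i = 0 then Units R else carrier R)"
    have u: "x 0 \<in> Units R" using PiE_mem[OF x', of 0] by simp
    have xi: "x i \<in> carrier R" if "i \<le> k" for i
      using PiE_mem[OF x', of i] that u by (auto split: if_splits)
    have x0: "x 0 \<in> carrier R" using xi by simp
    have x: "x \<in> carrier ?T" using x' xi by (auto simp: PiE_iff)
    define v where "v = inv (x 0)"
    have v: "v \<in> carrier R" "x 0 \<otimes> v = \<one>" using u by (simp_all add: v_def)
    \<comment> \<open>The inverse of (a, w) is (1 / a, - w / a^2).\<close>
    define y where "y = (\<lambda>i\<in>{..k}. if i = 0 then v else \<ominus> (v \<otimes> v \<otimes> x i))"
    have y: "y \<in> carrier ?T" using v xi by (simp add: y_def)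
    have "x \<otimes>\<^bsub>?T\<^esub> y = \<one>\<^bsub>?T\<^esub>"
    proof (rule triv_ext_eqI[OF T.m_closed[OF x y] T.one_closed])
      fix i assume i: "i \<le> k"
      have "x 0 \<otimes> (\<ominus> (v \<otimes> v \<otimes> x i)) \<oplus> x i \<otimes> v = \<ominus> ((x 0 \<otimes> v) \<otimes> v \<otimes> x i) \<oplus> x i \<otimes> v"
        using xi[OF i] x0 v(1) by algebra
      also have "\<dots> = \<zero>" unfolding v(2) using xi[OF i] v(1) by algebra
      finally show "(x \<otimes>\<^bsub>?T\<^esub> y) i = \<one>\<^bsub>?T\<^esub> i"
        using i v(2) by (simp add: y_def)
    qed
    then have "y \<otimes>\<^bsub>?T\<^esub> x = \<one>\<^bsub>?T\<^esub> \<and> x \<otimes>\<^bsub>?T\<^esub> y = \<one>\<^bsub>?T\<^esub>"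
      using T.m_comm[OF x y] by (simp only:)
    with x y show "x \<in> Units ?T" unfolding Units_def by blast
  qed
qed

lemma card_Units_triv_ext:
  "card (Units (triv_ext R k)) = card (Units R) * card (carrier R) ^ k"
proof -
  have "card (Units (triv_ext R k)) = (\<Prod>i\<le>k. if i = 0 then card (Units R) else card (carrier R))"
    unfolding Units_triv_ext by (simp add: card_PiE if_distrib)
  also have "\<dots> = card (Units R) * card (carrier R) ^ k"
    by (induction k) (simp_all add: mult_ac)
  finally show ?thesis .
qed

lemma card_carrier_triv_ext:
  "card (carrier (triv_ext R k)) = card (carrier R) ^ Suc k"
  by (simp add: card_PiE)

lemma finite_carrier_triv_ext:
  "finite (carrier R) \<Longrightarrow> finite (carrier (triv_ext R k))"
  by (simp add: finite_PiE)

end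

lemma Units_ring_iso:
  assumes "ring R" "f \<in> ring_iso R S"
  shows "Units S = f ` Units R"
proof -
  interpret ring R by fact
  have inj: "inj_on f (carrier R)" and surj: "f ` carrier R = carrier S"
    using assms(2) by (auto simp: ring_iso_def bij_betw_def)
  have mult: "f (x \<otimes>\<^bsub>R\<^esub> y) = f x \<otimes>\<^bsub>S\<^esub> f y" if "x \<in> carrier R" "y \<in> carrier R" for x y
    using assms(2) that by (simp add: ring_iso_def ring_hom_def)
  have one: "f \<one>\<^bsub>R\<^esub> = \<one>\<^bsub>S\<^esub>" using assms(2) by (simp add: ring_iso_def ring_hom_def)
  show ?thesis
  proof
    show "f ` Units R \<subseteq> Units S"
    proof
      fix z assume "z \<in> f ` Units R"
      then obtain x y where x: "x \<in> carrier R" "z = f x" and y: "y \<in> carrier R"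
        and xy: "y \<otimes>\<^bsub>R\<^esub> x = \<one>\<^bsub>R\<^esub>" "x \<otimes>\<^bsub>R\<^esub> y = \<one>\<^bsub>R\<^esub>"
        unfolding Units_def by blast
      have "f y \<otimes>\<^bsub>S\<^esub> z = \<one>\<^bsub>S\<^esub>" "z \<otimes>\<^bsub>S\<^esub> f y = \<one>\<^bsub>S\<^esub>"
        using mult[OF y x(1)] mult[OF x(1) y] x(2) xy one by simp_all
      then show "z \<in> Units S" using x y surj unfolding Units_def by blast
    qed
    show "Units S \<subseteq> f ` Units R"
    proof
      fix z assume "z \<in> Units S"
      then obtain w where "z \<in> carrier S" "w \<in> carrier S" and zw: "w \<otimes>\<^bsub>S\<^esub> z = \<one>\<^bsub>S\<^esub>" "z \<otimes>\<^bsub>S\<^esub> w = \<one>\<^bsub>S\<^esub>"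
        by (auto simp: Units_def)
      then obtain x y where x: "x \<in> carrier R" "z = f x" and y: "y \<in> carrier R" "w = f y"
        using surj by blast
      have "f (y \<otimes>\<^bsub>R\<^esub> x) = f \<one>\<^bsub>R\<^esub>" "f (x \<otimes>\<^bsub>R\<^esub> y) = f \<one>\<^bsub>R\<^esub>"
        using zw x y mult one by simp_all
      then have "y \<otimes>\<^bsub>R\<^esub> x = \<one>\<^bsub>R\<^esub>" "x \<otimes>\<^bsub>R\<^esub> y = \<one>\<^bsub>R\<^esub>"
        using inj_onD[OF inj] x(1) y(1) by simp_all
      then show "z \<in> f ` Units R" using x y unfolding Units_def by blast
    qed
  qed
qed

text \<open>A finite commutative ring has an isomorphic copy on any infinite type.\<close>

lemma finite_cring_transport:
  fixes R :: "('b, 'c) ring_scheme"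
  assumes "infinite (UNIV :: 'a set)" "cring R" "finite (carrier R)"
  shows "\<exists>A :: 'a ring. cring A \<and> finite (carrier A) \<and>
    card (carrier A) = card (carrier R) \<and> card (Units A) = card (Units R)"
proof -
  interpret cring R by fact
  obtain B :: "'a set" where "finite B" "card B = card (carrier R)"
    using infinite_arbitrarily_large[OF assms(1)] by blast
  then obtain f where "bij_betw f (carrier R) B"
    using finite_same_card_bij[OF assms(3)] by metis
  then have inj: "inj_on f (carrier R)" by (rule bij_betw_imp_inj_on)
  let ?A = "image_ring f R"
  have iso: "f \<in> ring_iso R ?A" using inj_imp_image_ring_iso[OF inj] .
  have hom: "f \<in> ring_hom R ?A" using iso by (simp add: ring_iso_def)
  interpret A: ring ?A using inj_imp_image_ring_is_ring[OF inj] .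
  have carr: "carrier ?A = f ` carrier R" by (rule image_ring_carrier)
  have "cring ?A"
  proof (rule cring.intro[OF A.ring_axioms], unfold_locales)
    fix x y assume "x \<in> carrier ?A" "y \<in> carrier ?A"
    then obtain a b where "a \<in> carrier R" "x = f a" "b \<in> carrier R" "y = f b"
      unfolding carr by blast
    then show "x \<otimes>\<^bsub>?A\<^esub> y = y \<otimes>\<^bsub>?A\<^esub> x"
      using hom m_comm ring_hom_mult by metis
  qed
  moreover have "finite (carrier ?A)" "card (carrier ?A) = card (carrier R)"
    unfolding carr using assms(3) card_image[OF inj] by simp_all
  moreover have "card (Units ?A) = card (Units R)"
    unfolding Units_ring_iso[OF ring_axioms iso]
    by (rule card_image[OF inj_on_subset[OF inj]]) (auto simp: Units_def)
  ultimately show ?thesis by blast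
qed

lemma RDirProd_cring:
  assumes "cring R" "cring S"
  shows "cring (RDirProd R S)"
proof -
  interpret R: cring R by fact
  interpret S: cring S by fact
  interpret P: ring "RDirProd R S" using RDirProd_ring[OF R.ring_axioms S.ring_axioms] .
  show ?thesis
    by (rule cring.intro[OF P.ring_axioms], unfold_locales)
      (auto simp: RDirProd_def DirProd_def monoid.defs R.m_comm S.m_comm)
qed

lemma Units_RDirProd: "Units (RDirProd R S) = Units R \<times> Units S"
  by (auto simp: Units_def RDirProd_def DirProd_def monoid.defs)

section \<open>Realisation and the possible numbers of units\<close>

text \<open>One factor \<open>(p ^ l - 1) * p ^ (l * k)\<close> is the number of units of the trivial extension \<open>F \<ltimes> F ^ k\<close> of
  the field \<open>F\<close> of order \<open>p ^ l\<close>; direct products combine the factors, and each product is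
  transported back to the given type. The empty product belongs to the zero ring.\<close>

lemma unit_shape_realised:
  assumes inf: "infinite (UNIV :: 'a set)"
    and shape: "unit_shape P n" and primes: "\<And>p. p \<in> P \<Longrightarrow> Factorial_Ring.prime p"
  shows "\<exists>A :: 'a ring. cring A \<and> finite (carrier A) \<and>
    {p. Factorial_Ring.prime p \<and> p dvd card (carrier A)} = P \<and> card (Units A) = n"
proof -
  obtain xs :: "(nat \<times> nat \<times> nat) list" where xs: "fst ` set xs = P" "\<forall>(p, l, k)\<in>set xs. l \<ge> 1"
    "n = (\<Prod>(p, l, k)\<leftarrow>xs. (p ^ l - 1) * p ^ (l * k))"
    using shape unfolding unit_shape_def by blast
  have "\<forall>(p, l, k)\<in>set xs. Factorial_Ring.prime p \<and> l \<ge> 1"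
  proof (intro ballI, clarify)
    fix p l k assume x: "(p, l, k) \<in> set xs"
    then have "p \<in> P" unfolding xs(1)[symmetric] by (rule image_eqI[rotated]) simp
    then show "Factorial_Ring.prime p \<and> l \<ge> 1" using primes xs(2) x by blast
  qed
  then have "\<exists>A :: 'a ring. cring A \<and> finite (carrier A) \<and>
    {p. Factorial_Ring.prime p \<and> p dvd card (carrier A)} = fst ` set xs \<and>
    card (Units A) = (\<Prod>(p, l, k)\<leftarrow>xs. (p ^ l - 1) * p ^ (l * k))"
  proof (induction xs)
    case Nil
    define Z :: "'a ring" where "Z = \<lparr>carrier = {undefined}, monoid.mult = (\<lambda>_ _. undefined),
      one = undefined, ring.zero = undefined, add = (\<lambda>_ _. undefined)\<rparr>"
    have "cring Z" by (intro cringI abelian_groupI comm_monoidI) (simp_all add: Z_def)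
    moreover have "carrier Z = {undefined}" by (simp add: Z_def)
    moreover have "Units Z = {undefined}" by (auto simp: Units_def Z_def)
    ultimately show ?case by (intro exI[of _ Z]) auto
  next
    case (Cons x xs)
    obtain p l k where x: "x = (p, l, k)" by (cases x)
    have p: "Factorial_Ring.prime p" and l: "l \<ge> 1" using Cons.prems x by auto
    have "\<forall>(p, l, k)\<in>set xs. Factorial_Ring.prime p \<and> l \<ge> 1" using Cons.prems by simp
    from Cons.IH[OF this] obtain A :: "'a ring" where A: "cring A" "finite (carrier A)"
      "{p. Factorial_Ring.prime p \<and> p dvd card (carrier A)} = fst ` set xs"
      "card (Units A) = (\<Prod>(p, l, k)\<leftarrow>xs. (p ^ l - 1) * p ^ (l * k))"
      by (elim exE conjE)
    obtain F :: "((int list \<times> nat) multiset \<Rightarrow> int) ring"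
      where F: "field F" "finite (carrier F)" "card (carrier F) = p ^ l"
      using exists_finite_field[OF p l] by blast
    interpret F: field F by (rule F(1))
    let ?T = "triv_ext F k"
    let ?R = "RDirProd A ?T"
    have R: "cring ?R" using RDirProd_cring[OF A(1) F.triv_ext_cring] .
    have fin: "finite (carrier ?R)"
      using A(2) F.finite_carrier_triv_ext[OF F(2), of k] unfolding RDirProd_carrier by (rule finite_cartesian_product)
    have cardT: "card (carrier ?T) = p ^ (l * Suc k)"
      unfolding F.card_carrier_triv_ext F(3) by (rule power_mult[symmetric])
    have unitsF: "card (Units F) = p ^ l - 1"
      unfolding F.field_Units F(3)[symmetric] by (rule card_Diff_singleton[OF F.zero_closed])
    have "l * Suc k > 0" using l by simp
    then have primesT: "{r. Factorial_Ring.prime r \<and> r dvd p ^ (l * Suc k)} = {p}"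
      using p by (auto simp: prime_dvd_power_nat_iff dest: primes_dvd_imp_eq)
    have "{r. Factorial_Ring.prime r \<and> r dvd card (carrier ?R)} =
        {r. Factorial_Ring.prime r \<and> r dvd card (carrier A)} \<union>
        {r. Factorial_Ring.prime r \<and> r dvd p ^ (l * Suc k)}"
      unfolding RDirProd_carrier card_cartesian_product cardT by (auto simp: prime_dvd_mult_iff)
    then have primesR: "{r. Factorial_Ring.prime r \<and> r dvd card (carrier ?R)} = fst ` set (x # xs)"
      unfolding A(3) primesT x by simp
    have unitsR: "card (Units ?R) = (\<Prod>(p, l, k)\<leftarrow>x # xs. (p ^ l - 1) * p ^ (l * k))"
      unfolding Units_RDirProd card_cartesian_product A(4) F.card_Units_triv_ext unitsF F(3)
      by (simp add: x power_mult)
    obtain B :: "'a ring" where B: "cring B" "finite (carrier B)"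
      "card (carrier B) = card (carrier ?R)" "card (Units B) = card (Units ?R)"
      using finite_cring_transport[OF inf R fin] by (elim exE conjE)
    have "{r. Factorial_Ring.prime r \<and> r dvd card (carrier B)} = fst ` set (x # xs)"
      unfolding B(3) by (rule primesR)
    moreover have "card (Units B) = (\<Prod>(p, l, k)\<leftarrow>x # xs. (p ^ l - 1) * p ^ (l * k))"
      unfolding B(4) by (rule unitsR)
    ultimately show ?case using B(1,2) by (intro exI[of _ B] conjI)
  qed
  then show ?thesis unfolding xs .
qed

lemma unit_shape_iff_indexed:
  "unit_shape S n \<longleftrightarrow>
    (\<exists>(s::nat) (p :: nat \<Rightarrow> nat) (l :: nat \<Rightarrow> nat) (k :: nat \<Rightarrow> nat).
       (\<forall>j\<in>{1..s}. p j \<in> S \<and> l j \<ge> 1) \<and>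
       (\<forall>q\<in>S. \<exists>j\<in>{1..s}. p j = q) \<and>
       n = (\<Prod>j=1..s. (p j ^ l j - 1) * p j ^ (l j * k j)))" (is "_ \<longleftrightarrow> ?indexed")
proof
  assume "unit_shape S n"
  then obtain xs :: "(nat \<times> nat \<times> nat) list" where xs: "fst ` set xs = S" "\<forall>(p, l, k)\<in>set xs. l \<ge> 1"
    "n = (\<Prod>(p, l, k)\<leftarrow>xs. (p ^ l - 1) * p ^ (l * k))"
    unfolding unit_shape_def by blast
  define p where "p j = fst (xs ! (j - 1))" for j
  define l where "l j = fst (snd (xs ! (j - 1)))" for j
  define k where "k j = snd (snd (xs ! (j - 1)))" for j
  have nth: "xs ! (j - 1) \<in> set xs" if "j \<in> {1..length xs}" for j
    using that by (intro nth_mem) auto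
  have "p j \<in> S \<and> l j \<ge> 1" if "j \<in> {1..length xs}" for j
  proof -
    obtain a b c where x: "xs ! (j - 1) = (a, b, c)" by (rule prod_cases3)
    have "(a, b, c) \<in> set xs" using nth[OF that] unfolding x .
    then have "b \<ge> 1" "a \<in> fst ` set xs" using xs(2) by force+
    then show ?thesis unfolding p_def l_def x xs(1) by simp
  qed
  moreover have "\<exists>j\<in>{1..length xs}. p j = q" if "q \<in> S" for q
  proof -
    have "q \<in> fst ` set xs" unfolding xs(1) by (rule that)
    then obtain x where x: "q = fst x" "x \<in> set xs" by (rule imageE)
    then obtain i where "i < length xs" "xs ! i = x" unfolding in_set_conv_nth by blast
    then show ?thesis using x(1) by (intro bexI[of _ "Suc i"]) (simp_all add: p_def)
  qed
  moreover have "n = (\<Prod>j=1..length xs. (p j ^ l j - 1) * p j ^ (l j * k j))"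
    unfolding xs(3) prod.list_conv_set_nth
    by (simp add: prod.atLeast1_atMost_eq p_def l_def k_def case_prod_beta atLeast0LessThan)
  ultimately show ?indexed by blast
next
  assume ?indexed
  then obtain s and p l k :: "nat \<Rightarrow> nat" where h: "\<forall>j\<in>{1..s}. p j \<in> S \<and> l j \<ge> 1"
    "\<forall>q\<in>S. \<exists>j\<in>{1..s}. p j = q"
    "n = (\<Prod>j=1..s. (p j ^ l j - 1) * p j ^ (l j * k j))" by blast
  have "n = (\<Prod>(p, l, k)\<leftarrow>map (\<lambda>j. (p j, l j, k j)) [1..<Suc s]. (p ^ l - 1) * p ^ (l * k))"
    unfolding h(3) using prod.distinct_set_conv_list[of "[1..<Suc s]" "\<lambda>j. (p j ^ l j - 1) * p j ^ (l j * k j)"]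
    by (simp add: comp_def atLeastLessThanSuc_atLeastAtMost del: upt_Suc)
  moreover have "set [1..<Suc s] = {1..s}" by (simp add: atLeastLessThanSuc_atLeastAtMost del: upt_Suc)
  then have "set (map (\<lambda>j. (p j, l j, k j)) [1..<Suc s]) = (\<lambda>j. (p j, l j, k j)) ` {1..s}"
    by (simp only: set_map)
  moreover have "p ` {1..s} = S" unfolding set_eq_iff image_iff using h(1,2) by metis
  then have "fst ` (\<lambda>j. (p j, l j, k j)) ` {1..s} = S" by (simp add: image_image)
  moreover have "\<forall>(p, l, k)\<in>(\<lambda>j. (p j, l j, k j)) ` {1..s}. l \<ge> 1" using h(1) by auto
  ultimately show "unit_shape S n"
    unfolding unit_shape_def
    by (intro exI[of _ "map (\<lambda>j. (p j, l j, k j)) [1..<Suc s]"]) (simp only: simp_thms)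
qed

text \<open>The units of \<open>A\<close> lie in the finite commutative subring \<open>unit_span A\<close>, which has the same units and
  the same characteristic.\<close>

theorem ring_unit_shape:
  assumes "ring A" and char: "ring_char A > 0"
    and fin: "finite (Units A)" and comm: "comm_group (units_of A)"
  shows "unit_shape {q. Factorial_Ring.prime q \<and> q dvd ring_char A} (card (Units A))"
proof -
  interpret ring A by fact
  interpret U: comm_group "units_of A" by (rule comm)
  let ?R = "A\<lparr>carrier := unit_span A\<rparr>"
  have commute: "u \<otimes>\<^bsub>A\<^esub> v = v \<otimes>\<^bsub>A\<^esub> u" if "u \<in> Units A" "v \<in> Units A" for u v
    using U.m_comm[of u v] that by (simp add: units_of_carrier units_of_mult)
  have "subcring (unit_span A) A"
    by (rule subcringI[OF unit_span_subring unit_span_commute[OF commute]])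
  moreover have "unit_span A \<subseteq> carrier A" by (rule subsetI) (rule unit_span_closed)
  ultimately interpret R: cring ?R by (simp only: subcring_iff)
  have finR: "finite (carrier ?R)" using finite_unit_span[OF char fin] by simp
  have "unit_shape {q. Factorial_Ring.prime q \<and> q dvd card (carrier ?R)} (card (Units ?R))"
    using finite_cring_unit_shape[OF R.cring_axioms finR] .
  moreover have "{q. Factorial_Ring.prime q \<and> q dvd card (carrier ?R)} =
      {q. Factorial_Ring.prime q \<and> q dvd ring_char A}"
    using R.prime_dvd_ring_char_iff[OF finR] unfolding ring_char_restrict by blast
  ultimately show ?thesis unfolding Units_unit_span by (simp only:)
qed

theorem corollary3p3:
  fixes S :: "nat set" and n :: nat
  assumes "infinite (UNIV :: 'a set)"
    and "finite S" and "S \<noteq> {}" and "\<And>q. q \<in> S \<Longrightarrow> Factorial_Ring.prime q"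
    and "n > 0"
  shows "(\<exists>A :: 'a ring. ring A \<and> ring_char A > 0 \<and>
            finite (Units A) \<and> comm_group (units_of A) \<and>
            {q. Factorial_Ring.prime q \<and> q dvd ring_char A} = S \<and>
            card (Units A) = n)
     \<longleftrightarrow>
         (\<exists>(s::nat) (p :: nat \<Rightarrow> nat) (l :: nat \<Rightarrow> nat) (k :: nat \<Rightarrow> nat).
            (\<forall>j\<in>{1..s}. p j \<in> S \<and> l j \<ge> 1) \<and>
            (\<forall>q\<in>S. \<exists>j\<in>{1..s}. p j = q) \<and>
            n = (\<Prod>j=1..s. (p j ^ l j - 1) * p j ^ (l j * k j)))"
  unfolding unit_shape_iff_indexed[symmetric]
proof
  assume "\<exists>A :: 'a ring. ring A \<and> ring_char A > 0 \<and> finite (Units A) \<and> comm_group (units_of A) \<and>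
    {q. Factorial_Ring.prime q \<and> q dvd ring_char A} = S \<and> card (Units A) = n"
  then show "unit_shape S n" using ring_unit_shape by blast
next
  assume "unit_shape S n"
  then obtain A :: "'a ring" where A: "cring A" "finite (carrier A)"
    "{p. Factorial_Ring.prime p \<and> p dvd card (carrier A)} = S" "card (Units A) = n"
    using unit_shape_realised[OF assms(1) _ assms(4)] by blast
  interpret A: cring A by (rule A(1))
  have "finite (Units A)" using A(2) by (rule finite_subset[rotated]) (auto simp: Units_def)
  moreover have "{q. Factorial_Ring.prime q \<and> q dvd ring_char A} = S"
    using A.prime_dvd_ring_char_iff[OF A(2)] A(3) by blast
  ultimately show "\<exists>A :: 'a ring. ring A \<and> ring_char A > 0 \<and> finite (Units A) \<and>
    comm_group (units_of A) \<and> {q. Factorial_Ring.prime q \<and> q dvd ring_char A} = S \<and> card (Units A) = n"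
    using A.ring_axioms A.ring_char_pos_of_finite[OF A(2)] A.units_comm_group A(4) by blast
qed

end
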